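(* Let $X$ be an infinite dimensional Banach space with separable dual for the "only if" direction below; precisely: for an infinite dimensional separable Banach space $X$, the dual $X^*$ is separable and has the bounded approximation property if and only if $X$ has a shrinking Schauder frame.
   Context: A separable Banach space $Y$ has the bounded approximation property (BAP) if there is a sequence $(B_n)$ of finite rank bounded linear operators on $Y$ such that $\lim_n\|y-B_ny\|=0$ for all $y\in Y$. A sequence of pairs $(x_i,f_i)_{i=1}^\infty$ in $X\times X^*$ with $x_i\neq 0$ for all $i$ is a Schauder frame for $X$ if $x=\sum_{i=1}^\infty f_i(x)x_i$ (norm convergence) for all $x\in X$. It is shrinking if $(f_i,x_i)_{i=1}^\infty$ is a Schauder frame for $X^*$, i.e. $f=\sum_{i=1}^\infty f(x_i)f_i$ in norm for all $f\in X^*$ (the nonvanishing convention is only for the $x_i$). *)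

theory Defs
  imports "HOL-Analysis.Analysis"
begin

text \<open>
  Banach spaces are real; the dual of \<open>'a\<close> is the Banach space \<open>'a \<Rightarrow>\<^sub>L real\<close> of bounded
  linear functionals with the operator norm.  Sequences are indexed from 0.
\<close>

definition finite_dim_set :: "'a::real_vector set \<Rightarrow> bool" where
  "finite_dim_set S \<longleftrightarrow> (\<exists>A. finite A \<and> S \<subseteq> span A)"

definition finite_rank :: "('a::real_normed_vector \<Rightarrow>\<^sub>L 'b::real_normed_vector) \<Rightarrow> bool" where
  "finite_rank T \<longleftrightarrow> finite_dim_set (range (blinfun_apply T))"

text \<open>
  This sequential form is meant for separable spaces only; separability is stated
  separately wherever it is used.
\<close>

definition bounded_approximation_property :: "'a::banach itself \<Rightarrow> bool" where
  "bounded_approximation_property (_ :: 'a itself) \<longleftrightarrow>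
     (\<exists>B :: nat \<Rightarrow> ('a \<Rightarrow>\<^sub>L 'a).
        (\<forall>n. finite_rank (B n)) \<and> (\<forall>y. (\<lambda>n. norm (y - B n y)) \<longlonglongrightarrow> 0))"

definition schauder_frame :: "(nat \<Rightarrow> 'a::banach \<times> ('a \<Rightarrow>\<^sub>L real)) \<Rightarrow> bool" where
  "schauder_frame p \<longleftrightarrow>
     (\<forall>i. fst (p i) \<noteq> 0) \<and> (\<forall>x. (\<lambda>i. snd (p i) x *\<^sub>R fst (p i)) sums x)"

text \<open>
  The sequence of pairs \<open>(f\<^sub>i, x\<^sub>i)\<close> expands the dual, with \<open>x\<^sub>i\<close> acting on functionals by
  evaluation; the \<open>f\<^sub>i\<close> are allowed to vanish.
\<close>

definition shrinking :: "(nat \<Rightarrow> 'a::banach \<times> ('a \<Rightarrow>\<^sub>L real)) \<Rightarrow> bool" where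
  "shrinking p \<longleftrightarrow>
     (\<forall>f :: 'a \<Rightarrow>\<^sub>L real. (\<lambda>i. blinfun_apply f (fst (p i)) *\<^sub>R snd (p i)) sums f)"

end

(* By duality T |-> T* it suffices to find uniformly bounded finite rank operators T_n on X with
   T_n x -> x and T_n* f -> f.  For finitely many x and f, suppose no T of norm at most 4(C+1) works,
   where C bounds the norms of the given operators B_n on X*.  Hahn-Banach gives a functional
   separating the data (x, f) from the (T x, T* f); evaluated on (B_n* x, B_n f) it is close to its
   value on (x, f), while local reflexivity in finite rank bounds it by the values on (T x, T* f):
   a contradiction.  Given T_n, each difference T_{n+1} - T_n is a sum of rank one operators; running
   m times through this sum with weight 1/m, for m large, keeps all partial sums under control, and
   concatenating these blocks yields the frame. *)

theory Submission
  imports Defs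
begin

section \<open>The Hahn--Banach theorem and uniform boundedness\<close>

text \<open>The obstacle is that a finite rank operator on the dual need not be an adjoint: it is a
  sum of tensors of functionals \<open>g j\<close> with the bidual elements sending h to
  \<open>B h (u j)\<close>, whereas an adjoint has vectors of the space in their place. Local
  reflexivity exchanges the two, but only for estimates on finitely many data, hence the argument by
  contradiction. Both kinds of data sit in one product space because a single \<open>T\<close> must
  serve them together. The constant comes from a margin: the functional is at least 1 on the data
  and at most \<open>norm T / c\<close> on operators, local reflexivity loses a factor 2, and 2 C /
  (4 (C + 1)) < 1/2. The uniform norm bound permits testing convergence on dense sequences only. The
  differences of consecutive operators are known to tend to zero only pointwise, and their rank one
  pieces need not be small at all; the weights make the partial sums close, in operator norm, to
  multiples of the whole difference, an error that is small on the space and on its dual at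
  once.\<close>

lemma dominated_subspace_extend:
  fixes p :: "'a::real_vector \<Rightarrow> real" and G :: "('a \<times> real) set"
  assumes subadd: "\<And>x y. p (x + y) \<le> p x + p y"
    and hom: "\<And>c x. 0 < c \<Longrightarrow> p (c *\<^sub>R x) = c * p x"
    and G: "subspace G" and dom: "\<And>x r. (x, r) \<in> G \<Longrightarrow> r \<le> p x"
  obtains a where "\<And>x r. (x, r) \<in> span (insert (x0, a) G) \<Longrightarrow> r \<le> p x"
proof -
  have key: "r - p (x - x0) \<le> p (y + x0) - s" if "(x, r) \<in> G" "(y, s) \<in> G" for x r y s
  proof -
    have "(x + y, r + s) \<in> G"
      using subspace_add[OF G that] by simp
    then have "r + s \<le> p ((x - x0) + (y + x0))"
      using dom by (simp add: algebra_simps)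
    also have "\<dots> \<le> p (x - x0) + p (y + x0)"
      by (rule subadd)
    finally show ?thesis by simp
  qed
  have z: "(0, 0) \<in> G"
    using subspace_0[OF G] by (simp add: zero_prod_def)
  \<comment> \<open>\<open>key\<close> puts every lower bound \<open>r - p (x - x0)\<close> for the
    new value below every upper bound \<open>p (y + x0) - s\<close>; the supremum of the lower
    bounds lies in between.\<close>
  define Q where "Q = (\<lambda>(x, r). r - p (x - x0)) ` G"
  define a where "a = Sup Q"
  have bdd: "bdd_above Q"
    unfolding Q_def bdd_above_def using key[OF _ z] by fastforce
  have lo: "r - p (x - x0) \<le> a" if "(x, r) \<in> G" for x r
    unfolding a_def using that bdd by (intro cSup_upper) (auto simp: Q_def)
  have hi: "a \<le> p (y + x0) - s" if "(y, s) \<in> G" for y s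
    unfolding a_def using key[OF _ that] z by (intro cSup_least) (auto simp: Q_def)
  show thesis
  proof (rule that)
    fix x r assume "(x, r) \<in> span (insert (x0, a) G)"
    then obtain t where "(x, r) - t *\<^sub>R (x0, a) \<in> span G"
      by (auto simp: span_insert)
    moreover have "span G = G"
      using G by (simp add: span_eq_iff)
    ultimately have t: "(x - t *\<^sub>R x0, r - t * a) \<in> G"
      by simp
    have sc: "((1 / c) *\<^sub>R (x - t *\<^sub>R x0), (1 / c) * (r - t * a)) \<in> G" for c :: real
      using subspace_scale[OF G t, of "1 / c"] by simp
    \<comment> \<open>Dividing by the absolute value of \<open>t\<close> turns the coefficient of
      \<open>x0\<close> into 1 or -1, where \<open>hi\<close> or \<open>lo\<close> applies.\<close>
    consider "t = 0" | "t > 0" | "t < 0" by linarith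
    then show "r \<le> p x"
    proof cases
      case 1
      then show ?thesis using dom t by simp
    next
      case 2
      have "(1 / t) *\<^sub>R (x - t *\<^sub>R x0) + x0 = (1 / t) *\<^sub>R x"
        using 2 by (simp add: algebra_simps)
      then have "a \<le> p ((1 / t) *\<^sub>R x) - (1 / t) * (r - t * a)"
        using hi[OF sc[of t]] by simp
      then show ?thesis using 2 by (simp add: hom field_simps)
    next
      case 3
      have "(1 / (- t)) *\<^sub>R (x - t *\<^sub>R x0) - x0 = (1 / (- t)) *\<^sub>R x"
        using 3 by (simp add: algebra_simps)
      then have "(1 / (- t)) * (r - t * a) - p ((1 / (- t)) *\<^sub>R x) \<le> a"
        using lo[OF sc[of "- t"]] by simp
      moreover have "p ((1 / (- t)) *\<^sub>R x) = (1 / (- t)) * p x"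
        using 3 by (intro hom) auto
      ultimately show ?thesis using 3 by (simp add: field_simps)
    qed
  qed
qed

text \<open>The functional to be extended is given by its graph, so its well-definedness need not be
  checked: domination by \<open>p\<close> forces it.\<close>

theorem hahn_banach_graph:
  fixes p :: "'a::real_vector \<Rightarrow> real" and G :: "('a \<times> real) set"
  assumes subadd: "\<And>x y. p (x + y) \<le> p x + p y"
    and hom: "\<And>c x. 0 < c \<Longrightarrow> p (c *\<^sub>R x) = c * p x"
    and G: "subspace G" and dom: "\<And>x r. (x, r) \<in> G \<Longrightarrow> r \<le> p x"
  obtains F where "linear F" "\<And>x. F x \<le> p x" "\<And>x r. (x, r) \<in> G \<Longrightarrow> F x = r"
proof -
  define A where "A = {H. subspace H \<and> G \<subseteq> H \<and> (\<forall>x r. (x, r) \<in> H \<longrightarrow> r \<le> p x)}"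
  have "\<exists>M\<in>A. \<forall>X\<in>A. M \<subseteq> X \<longrightarrow> X = M"
  proof (rule subset_Zorn_nonempty)
    show "A \<noteq> {}" using G dom by (auto simp: A_def)
    fix C assume C: "C \<noteq> {}" "subset.chain A C"
    have sub: "subspace H" if "H \<in> C" for H
      using C(2) that by (auto simp: A_def subset.chain_def)
    have tot: "H \<subseteq> K \<or> K \<subseteq> H" if "H \<in> C" "K \<in> C" for H K
      using C(2) that by (auto simp: subset.chain_def)
    have sC: "subspace (\<Union>C)"
      unfolding subspace_def
    proof (intro conjI ballI allI)
      show "0 \<in> \<Union>C" using C(1) sub subspace_0 by blast
      show "c *\<^sub>R x \<in> \<Union>C" if "x \<in> \<Union>C" for c x
        using that sub subspace_scale by blast
      show "x + y \<in> \<Union>C" if "x \<in> \<Union>C" "y \<in> \<Union>C" for x y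
      proof -
        obtain H K where "x \<in> H" "H \<in> C" "y \<in> K" "K \<in> C"
          using \<open>x \<in> \<Union>C\<close> \<open>y \<in> \<Union>C\<close> by blast
        with tot[of H K] have "x \<in> H \<and> y \<in> H \<or> x \<in> K \<and> y \<in> K" by auto
        then have "x + y \<in> H \<or> x + y \<in> K"
          using sub[OF \<open>H \<in> C\<close>] sub[OF \<open>K \<in> C\<close>] by (auto intro: subspace_add)
        then show ?thesis
          using \<open>H \<in> C\<close> \<open>K \<in> C\<close> by auto
      qed
    qed
    have CA: "\<And>H. H \<in> C \<Longrightarrow> H \<in> A"
      using C(2) by (auto simp: subset.chain_def)
    have "G \<subseteq> \<Union>C" "\<forall>x r. (x, r) \<in> \<Union>C \<longrightarrow> r \<le> p x"
      using C(1) CA unfolding A_def by blast+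
    with sC show "\<Union>C \<in> A" by (simp add: A_def)
  qed
  then obtain M where M: "M \<in> A" and mx: "\<And>X. X \<in> A \<Longrightarrow> M \<subseteq> X \<Longrightarrow> X = M" by blast
  have sM: "subspace M" and GM: "G \<subseteq> M" and dM: "\<And>x r. (x, r) \<in> M \<Longrightarrow> r \<le> p x"
    using M by (auto simp: A_def)
  have tot: "\<exists>r. (x, r) \<in> M" for x
  proof -
    obtain a where a: "\<And>y r. (y, r) \<in> span (insert (x, a) M) \<Longrightarrow> r \<le> p y"
      using dominated_subspace_extend[where p = p and G = M, OF subadd hom sM dM] by blast
    have sup: "insert (x, a) M \<subseteq> span (insert (x, a) M)"
      by (rule span_superset)
    have "span (insert (x, a) M) \<in> A"
      using a GM sup by (auto simp: A_def)
    then have "span (insert (x, a) M) = M"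
      using sup by (intro mx) auto
    with sup show ?thesis by blast
  qed
  have p0: "p 0 = 0"
    using hom[of 2 0] by simp
  have uniq: "r = s" if "(x, r) \<in> M" "(x, s) \<in> M" for x r s
  proof -
    \<comment> \<open>The vertical vector and its negative both lie in \<open>M\<close>, so
      \<open>p 0 = 0\<close> bounds the gap from both sides.\<close>
    have "(0, r - s) \<in> M" "(0, s - r) \<in> M"
      using subspace_diff[OF sM that] subspace_diff[OF sM that(2,1)] by simp_all
    then have "r - s \<le> 0" "s - r \<le> 0" using dM p0 by metis+
    then show ?thesis by simp
  qed
  define F where "F x = (THE r. (x, r) \<in> M)" for x
  have FM: "(x, F x) \<in> M" for x
    unfolding F_def using tot[of x] uniq by (metis theI')
  have Feq: "F x = r" if "(x, r) \<in> M" for x r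
    using uniq FM that by blast
  show thesis
  proof
    show "linear F"
    proof (rule linearI)
      show "F (x + y) = F x + F y" for x y
        using subspace_add[OF sM FM FM] by (intro Feq) simp
      show "F (c *\<^sub>R x) = c *\<^sub>R F x" for c x
        using subspace_scale[OF sM FM] by (intro Feq) simp
    qed
    show "F x \<le> p x" for x using dM FM by blast
    show "F x = r" if "(x, r) \<in> G" for x r using Feq GM that by blast
  qed
qed

text \<open>The gauge \<open>c * norm x\<close> is even, so the one-sided bound from the extension,
  used at \<open>x\<close> and at \<open>- x\<close>, bounds the functional in norm.\<close>

lemma hahn_banach_norm:
  fixes G :: "('a::real_normed_vector \<times> real) set"
  assumes "subspace G" "\<And>x r. (x, r) \<in> G \<Longrightarrow> r \<le> c * norm x" "0 \<le> c"
  obtains F :: "'a \<Rightarrow>\<^sub>L real" where "norm F \<le> c" "\<And>x r. (x, r) \<in> G \<Longrightarrow> F x = r"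
proof -
  obtain F where F: "linear F" "\<And>x. F x \<le> c * norm x" "\<And>x r. (x, r) \<in> G \<Longrightarrow> F x = r"
  proof (rule hahn_banach_graph[where p = "\<lambda>x. c * norm x" and G = G])
    show "c * norm (x + y) \<le> c * norm x + c * norm y" for x y :: 'a
      using assms(3) norm_triangle_ineq[of x y] by (metis distrib_left mult_left_mono)
  qed (use assms in auto)
  have ab: "\<bar>F x\<bar> \<le> c * norm x" for x
    using F(2)[of x] F(2)[of "- x"] linear_neg[OF F(1), of x] by auto
  then have bl: "bounded_linear F"
    using F(1) by (intro bounded_linear_intro[where K = c])
      (auto simp: linear_add linear_cmul mult.commute)
  show thesis
  proof
    show "norm (Blinfun F) \<le> c"
      using ab assms(3) bl by (intro norm_blinfun_bound) (auto simp: bounded_linear_Blinfun_apply)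
    show "Blinfun F x = r" if "(x, r) \<in> G" for x r
      using F(3)[OF that] bl by (simp add: bounded_linear_Blinfun_apply)
  qed
qed

text \<open>The sublinear functional \<open>z \<mapsto> inf (\<parallel>z - L T\<parallel> / e + \<parallel>T\<parallel> / c)\<close> over \<open>T \<in> S\<close> is at least
  \<open>1\<close> at \<open>v\<close>.\<close>

lemma separate_from_linear_image:
  fixes L :: "'w::real_normed_vector \<Rightarrow> 'z::real_normed_vector" and S :: "'w set"
  assumes S: "subspace S" and L: "linear L" and e: "0 < e" and c: "0 < c"
    and far: "\<And>T. T \<in> S \<Longrightarrow> norm T \<le> c \<Longrightarrow> e \<le> norm (v - L T)"
  obtains F :: "'z \<Rightarrow>\<^sub>L real" where "1 \<le> F v" "\<And>T. T \<in> S \<Longrightarrow> F (L T) \<le> norm T / c"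
proof -
  define q where "q z T = norm (z - L T) / e + norm T / c" for z T
  define p where "p z = Inf (q z ` S)" for z
  have q0: "0 \<le> q z T" for z T
    using e c by (simp add: q_def)
  have S0: "0 \<in> S" using S by (rule subspace_0)
  have bdd: "bdd_below (q z ` S)" for z
    using q0 by (auto simp: bdd_below_def)
  have ple: "p z \<le> q z T" if "T \<in> S" for z T
    unfolding p_def using bdd that by (intro cInf_lower) auto
  have lep: "b \<le> p z" if "\<And>T. T \<in> S \<Longrightarrow> b \<le> q z T" for b z
    unfolding p_def using that S0 by (intro cInf_greatest) auto
  have subadd: "p (x + y) \<le> p x + p y" for x y
  proof -
    have qadd: "q (x + y) (T + U) \<le> q x T + q y U" for T U
    proof -
      have "norm (x + y - L (T + U)) \<le> norm (x - L T) + norm (y - L U)"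
        using norm_triangle_ineq[of "x - L T" "y - L U"]
        by (simp add: linear_add[OF L] algebra_simps)
      moreover have "norm (T + U) \<le> norm T + norm U"
        by (rule norm_triangle_ineq)
      ultimately have "q (x + y) (T + U)
          \<le> (norm (x - L T) + norm (y - L U)) / e + (norm T + norm U) / c"
        unfolding q_def using e c by (intro add_mono divide_right_mono) auto
      then show ?thesis by (simp add: q_def add_divide_distrib)
    qed
    have "p (x + y) - q x T \<le> p y" if T: "T \<in> S" for T
    proof (rule lep)
      fix U assume "U \<in> S"
      then have "p (x + y) \<le> q (x + y) (T + U)"
        using T S by (intro ple subspace_add)
      then show "p (x + y) - q x T \<le> q y U" using qadd[of T U] by linarith
    qed
    then have "p (x + y) - p y \<le> p x"
      by (intro lep) (auto simp: algebra_simps)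
    then show ?thesis by linarith
  qed
  have hom: "p (t *\<^sub>R x) = t * p x" if t: "0 < t" for t x
  proof -
    have qs: "q (s *\<^sub>R y) (s *\<^sub>R T) = s * q y T" if "0 < s" for s y T
      using that
      by (simp add: q_def linear_cmul[OF L] distrib_left flip: scaleR_diff_right)
    have le: "p (s *\<^sub>R y) \<le> s * p y" if "0 < s" for s y
    proof -
      have "p (s *\<^sub>R y) / s \<le> p y"
      proof (rule lep)
        fix T assume "T \<in> S"
        then have "p (s *\<^sub>R y) \<le> q (s *\<^sub>R y) (s *\<^sub>R T)"
          using S by (intro ple subspace_scale)
        then show "p (s *\<^sub>R y) / s \<le> q y T"
          using that by (simp add: qs field_simps)
      qed
      then show ?thesis using that by (simp add: field_simps)
    qed
    have "p x \<le> (1 / t) * p (t *\<^sub>R x)"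
      using le[of "1 / t" "t *\<^sub>R x"] t by simp
    then have "t * p x \<le> p (t *\<^sub>R x)"
      using t by (simp add: field_simps)
    with le[OF t, of x] show ?thesis by linarith
  qed
  \<comment> \<open>The competitor \<open>T = 0\<close> bounds \<open>p\<close> by a multiple of the
    norm; this makes the separating functional continuous.\<close>
  have pn: "p z \<le> (1 / e) * norm z" for z
    using ple[OF S0, of z] by (simp add: q_def linear_0[OF L])
  have pL: "p (L T) \<le> norm T / c" if "T \<in> S" for T
    using ple[OF that, of "L T"] by (simp add: q_def)
  \<comment> \<open>Up to norm \<open>c\<close> the residual term of \<open>q\<close> is at least 1
    by \<open>far\<close>; beyond it the penalty term is.\<close>
  have pv: "1 \<le> p v"
  proof (rule lep)
    fix T assume T: "T \<in> S"
    show "1 \<le> q v T"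
    proof (cases "norm T \<le> c")
      case True
      then have "1 \<le> norm (v - L T) / e" using far[OF T] e by simp
      then show ?thesis using c by (simp add: q_def add_increasing2)
    next
      case False
      then have "1 \<le> norm T / c" using c by simp
      then show ?thesis using e by (simp add: q_def add_increasing)
    qed
  qed
  \<comment> \<open>The extension starts from the line through \<open>v\<close>; multiples by
    \<open>t \<le> 0\<close> are dominated because \<open>p\<close> is nonnegative.\<close>
  define G where "G = span {(v, p v)}"
  have dom: "r \<le> p x" if "(x, r) \<in> G" for x r
  proof -
    obtain t where t: "x = t *\<^sub>R v" "r = t * p v"
      using \<open>(x, r) \<in> G\<close> by (auto simp: G_def span_singleton)
    consider "t > 0" | "t \<le> 0" by linarith
    then show ?thesis
    proof cases
      case 1
      then show ?thesis by (simp add: t hom)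
    next
      case 2
      have "0 \<le> p x" using q0 by (intro lep)
      moreover have "t * p v \<le> 0" using 2 pv by (simp add: mult_nonpos_nonneg)
      ultimately show ?thesis by (simp add: t)
    qed
  qed
  obtain F where F: "linear F" "\<And>x. F x \<le> p x" "\<And>x r. (x, r) \<in> G \<Longrightarrow> F x = r"
    using hahn_banach_graph[where p = p and G = G, OF subadd hom _ dom] by (auto simp: G_def)
  have ab: "\<bar>F x\<bar> \<le> (1 / e) * norm x" for x
    using order_trans[OF F(2) pn, of x] order_trans[OF F(2) pn, of "- x"]
      linear_neg[OF F(1), of x] by auto
  then have bl: "bounded_linear F"
    using F(1) by (intro bounded_linear_intro[where K = "1 / e"])
      (auto simp: linear_add linear_cmul mult.commute)
  show thesis
  proof
    have "F v = p v" by (rule F(3)) (simp add: G_def span_base)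
    then show "1 \<le> Blinfun F v"
      using pv bl by (simp add: bounded_linear_Blinfun_apply)
    show "Blinfun F (L T) \<le> norm T / c" if "T \<in> S" for T
      using order_trans[OF F(2) pL[OF that]] bl by (simp add: bounded_linear_Blinfun_apply)
  qed
qed

text \<open>Banach-Steinhaus by Baire category: one of the closed sets \<open>K m\<close> contains a
  ball, and every short vector is a difference of two points of that ball.\<close>

lemma uniform_boundedness:
  fixes B :: "nat \<Rightarrow> 'a::banach \<Rightarrow>\<^sub>L 'b::real_normed_vector"
  assumes "\<And>x. Bseq (\<lambda>n. B n x)"
  obtains C where "\<And>n. norm (B n) \<le> C"
proof -
  define K where "K m = {x. \<forall>n. norm (B n x) \<le> real m}" for m :: nat
  have cl: "closed (K m)" for m
    unfolding K_def by (intro closed_Collect_all closed_Collect_le continuous_intros)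
  have un: "(\<Union>m. K m) = UNIV"
  proof -
    have "\<exists>m. x \<in> K m" for x
    proof -
      obtain c where "\<And>n. norm (B n x) \<le> c"
        using assms[of x] by (auto simp: Bseq_def)
      moreover obtain m :: nat where "c \<le> real m" using real_arch_simple by blast
      ultimately show ?thesis unfolding K_def by (auto intro: order_trans)
    qed
    then show ?thesis by auto
  qed
  have "\<exists>m. interior (K m) \<noteq> {}"
  proof (rule ccontr)
    assume "\<nexists>m. interior (K m) \<noteq> {}"
    then have "interior (\<Union>(range K)) = {}"
      using Met_TC.metric_Baire_category_alt[of "range K"] cl
      by (auto simp: complete_UNIV)
    then show False using un by simp
  qed
  then obtain m x r where r: "0 < r" "ball x r \<subseteq> K m"
    by (auto simp: mem_interior)
  have "norm (B n) \<le> 4 * real m / r" for n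
  proof (rule norm_blinfun_bound)
    show "0 \<le> 4 * real m / r" using r by simp
    fix y
    show "norm (B n y) \<le> 4 * real m / r * norm y"
    proof (cases "y = 0")
      case False
      \<comment> \<open>\<open>t *\<^sub>R y\<close> has norm \<open>r / 2\<close>, so the bound
        \<open>2 * m\<close> there rescales to \<open>4 * m / r\<close>.\<close>
      define t where "t = r / (2 * norm y)"
      have t: "0 < t" "norm (t *\<^sub>R y) < r"
        using False r by (auto simp: t_def)
      have "x \<in> K m" "x + t *\<^sub>R y \<in> K m"
        using r t by (auto simp: dist_norm intro!: subsetD[OF r(2)])
      then have "norm (B n x) \<le> m" "norm (B n (x + t *\<^sub>R y)) \<le> m"
        by (auto simp: K_def)
      moreover have "B n (t *\<^sub>R y) = B n (x + t *\<^sub>R y) - B n x"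
        by (simp add: blinfun.bilinear_simps)
      ultimately have "norm (B n (t *\<^sub>R y)) \<le> 2 * m"
        using norm_triangle_ineq4[of "B n (x + t *\<^sub>R y)" "B n x"] by simp
      then have "t * norm (B n y) \<le> 2 * m"
        using t by (simp add: blinfun.bilinear_simps)
      then show ?thesis using False r by (simp add: t_def field_simps)
    qed simp
  qed
  then show thesis by (rule that)
qed

section \<open>Local reflexivity in finite rank\<close>

text \<open>Induction in Gram-Schmidt style. \<open>P\<close> fixes the old span, and
  \<open>b = a - P a\<close> vanishes at all old \<open>u j\<close>. If \<open>b\<close> is not
  zero, it is normalised at a point \<open>w\<close>, and multiples of it are subtracted from the
  old \<open>g j\<close> so that they vanish at \<open>w\<close>. All coordinates are evaluations at
  points of the space.\<close>

lemma finite_span_dual_basis: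
  fixes A :: "('a::real_normed_vector \<Rightarrow>\<^sub>L real) set"
  assumes "finite A"
  shows "\<exists>(d::nat) (g :: nat \<Rightarrow> 'a \<Rightarrow>\<^sub>L real) u.
    (\<forall>i<d. \<forall>j<d. blinfun_apply (g i) (u j) = (if i = j then 1 else 0)) \<and>
    (\<forall>f\<in>span A. f = (\<Sum>j<d. blinfun_apply f (u j) *\<^sub>R g j))"
  using assms
proof (induction A rule: finite_induct)
  case empty
  show ?case by (rule exI[of _ 0]) auto
next
  case (insert a A)
  then obtain d and g :: "nat \<Rightarrow> 'a \<Rightarrow>\<^sub>L real" and u
    where gu: "\<And>i j. i < d \<Longrightarrow> j < d \<Longrightarrow> g i (u j) = (if i = j then 1 else 0)"
      and rep: "\<And>f. f \<in> span A \<Longrightarrow> f = (\<Sum>j<d. blinfun_apply f (u j) *\<^sub>R g j)"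
    by blast
  define P :: "('a \<Rightarrow>\<^sub>L real) \<Rightarrow> _" where "P f = (\<Sum>j<d. blinfun_apply f (u j) *\<^sub>R g j)" for f
  have Plin: "P (f - k *\<^sub>R h) = P f - k *\<^sub>R P h" for f h k
    unfolding P_def
    by (simp add: blinfun.bilinear_simps scaleR_diff_left sum_subtractf scaleR_sum_right)
  define b where "b = a - P a"
  have expand: "\<exists>k. f - P f = k *\<^sub>R b" if "f \<in> span (insert a A)" for f
  proof -
    obtain k where "f - k *\<^sub>R a \<in> span A"
      using \<open>f \<in> span (insert a A)\<close> unfolding span_breakdown_eq by blast
    then have "f - k *\<^sub>R a = P (f - k *\<^sub>R a)" using rep by (simp add: P_def)
    then have "f - P f = k *\<^sub>R b"
      by (simp add: Plin b_def algebra_simps)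
    then show ?thesis ..
  qed
  show ?case
  proof (cases "b = 0")
    case True
    then have "f = P f" if "f \<in> span (insert a A)" for f
      using expand[OF that] by auto
    then show ?thesis using gu unfolding P_def by blast
  next
    case False
    then obtain w where w: "b w \<noteq> 0"
      by (metis blinfun_eqI zero_blinfun.rep_eq)
    have bu: "b (u j) = 0" if "j < d" for j
    proof -
      have "P a (u j) = (\<Sum>i<d. a (u i) * g i (u j))"
        by (simp add: P_def blinfun.sum_left blinfun.scaleR_left)
      also have "\<dots> = (\<Sum>i<d. if i = j then a (u j) else 0)"
        using gu that by (intro sum.cong) auto
      finally show ?thesis using that by (simp add: b_def blinfun.diff_left)
    qed
    define g' where "g' j = (if j < d then g j - (g j w / b w) *\<^sub>R b else (1 / b w) *\<^sub>R b)" for j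
    define u' where "u' = u(d := w)"
    have "g' i (u' j) = (if i = j then 1 else 0)" if "i < Suc d" "j < Suc d" for i j
      using that w gu bu by (auto simp: g'_def u'_def less_Suc_eq blinfun.bilinear_simps)
    moreover have "f = (\<Sum>j<Suc d. blinfun_apply f (u' j) *\<^sub>R g' j)" if f: "f \<in> span (insert a A)" for f
    proof -
      obtain k where k: "f - P f = k *\<^sub>R b" using expand[OF f] by blast
      then have "f w - P f w = k * b w"
        by (metis blinfun.diff_left blinfun.scaleR_left real_scaleR_def)
      then have kw: "k = (f w - P f w) / b w" using w by simp
      have "(\<Sum>j<Suc d. blinfun_apply f (u' j) *\<^sub>R g' j)
          = (\<Sum>j<d. blinfun_apply f (u j) *\<^sub>R (g j - (g j w / b w) *\<^sub>R b)) + f w *\<^sub>R (1 / b w) *\<^sub>R b"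
        by (simp add: g'_def u'_def)
      also have "(\<Sum>j<d. blinfun_apply f (u j) *\<^sub>R (g j - (g j w / b w) *\<^sub>R b))
          = P f - (P f w / b w) *\<^sub>R b"
        by (simp add: P_def scaleR_diff_right sum_subtractf blinfun.sum_left blinfun.scaleR_left
            scaleR_sum_left sum_divide_distrib)
      finally have "(\<Sum>j<Suc d. blinfun_apply f (u' j) *\<^sub>R g' j) = P f + k *\<^sub>R b"
        unfolding kw by (simp add: diff_divide_distrib scaleR_diff_left)
      then show ?thesis using k by (simp add: algebra_simps)
    qed
    ultimately show ?thesis by blast
  qed
qed

section \<open>Finite tuples with the supremum norm, and their dual\<close>

text \<open>A type cannot depend on the length \<open>N\<close>, so tuples are placed in the normed
  type of bounded continuous functions on \<open>nat\<close>, where continuity is automatic.\<close>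

definition finseq :: "nat \<Rightarrow> (nat \<Rightarrow> 'a::real_normed_vector) \<Rightarrow> (nat \<Rightarrow>\<^sub>C 'a)" where
  "finseq N v = Bcontfun (\<lambda>k. if k < N then v k else 0)"

lemma apply_finseq [simp]: "apply_bcontfun (finseq N v) k = (if k < N then v k else 0)"
proof -
  have "norm (if k < N then v k else 0) \<le> (\<Sum>k<N. norm (v k))" for k
    by (auto intro: member_le_sum sum_nonneg)
  then have "(\<lambda>k. if k < N then v k else 0) \<in> bcontfun"
    by (intro bcontfun_normI[where b = "\<Sum>k<N. norm (v k)"])
      (auto simp: continuous_on_open_vimage open_discrete)
  then show ?thesis by (simp add: finseq_def Bcontfun_inverse)
qed

lemma finseq_add: "finseq N (\<lambda>k. v k + w k) = finseq N v + finseq N w"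
  by (rule bcontfun_eqI) auto

lemma finseq_scaleR: "finseq N (\<lambda>k. c *\<^sub>R v k) = c *\<^sub>R finseq N v"
  by (rule bcontfun_eqI) auto

lemma finseq_diff: "finseq N (\<lambda>k. v k - w k) = finseq N v - finseq N w"
  by (rule bcontfun_eqI) auto

lemma norm_finseq_le: "(\<And>k. k < N \<Longrightarrow> norm (v k) \<le> c) \<Longrightarrow> 0 \<le> c \<Longrightarrow> norm (finseq N v) \<le> c"
  by (rule norm_bound) auto

lemma norm_le_finseq: "k < N \<Longrightarrow> norm (v k) \<le> norm (finseq N v)"
  using norm_bounded[of "finseq N v" k] by simp

text \<open>A tuple is a shorter tuple plus its last entry, and embedding that entry by
  \<open>e\<close> has norm at most 1; composing \<open>F\<close> with \<open>e\<close> gives the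
  next functional.\<close>

lemma functional_on_finseq:
  fixes F :: "(nat \<Rightarrow>\<^sub>C 'a::real_normed_vector) \<Rightarrow>\<^sub>L real"
  obtains h :: "nat \<Rightarrow> 'a \<Rightarrow>\<^sub>L real" where "\<And>v. F (finseq N v) = (\<Sum>k<N. h k (v k))"
proof -
  have "\<exists>h :: nat \<Rightarrow> 'a \<Rightarrow>\<^sub>L real. \<forall>v. F (finseq N v) = (\<Sum>k<N. h k (v k))"
  proof (induction N)
    case 0
    have "finseq 0 v = 0" for v :: "nat \<Rightarrow> 'a" by (rule bcontfun_eqI) auto
    then show ?case by (simp add: blinfun.bilinear_simps)
  next
    case (Suc N)
    then obtain h :: "nat \<Rightarrow> 'a \<Rightarrow>\<^sub>L real" where h: "\<And>v. F (finseq N v) = (\<Sum>k<N. h k (v k))"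
      by blast
    define e where "e x = finseq (Suc N) (\<lambda>i. if i = N then x else 0)" for x :: 'a
    have bl: "bounded_linear e"
    proof (rule bounded_linear_intro[where K = 1])
      show "e (x + y) = e x + e y" "e (c *\<^sub>R x) = c *\<^sub>R e x" for x y c
        unfolding e_def by (rule bcontfun_eqI; simp)+
      show "norm (e x) \<le> norm x * 1" for x
        unfolding e_def by (auto intro: norm_finseq_le)
    qed
    have "finseq (Suc N) v = finseq N v + e (v N)" for v
      unfolding e_def by (rule bcontfun_eqI) (auto simp: less_Suc_eq)
    then have "F (finseq (Suc N) v) = (\<Sum>k<Suc N. (h(N := F o\<^sub>L Blinfun e)) k (v k))" for v
      using bl by (simp add: h blinfun.bilinear_simps bounded_linear_Blinfun_apply)
    then show ?case by blast
  qed
  then show thesis using that by blast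
qed

lemma functional_almost_norming:
  fixes f :: "'a::real_normed_vector \<Rightarrow>\<^sub>L real"
  assumes "0 < e"
  obtains x where "norm x \<le> 1" "norm f - e \<le> f x"
proof -
  have "\<exists>x. norm x \<le> 1 \<and> norm f - e \<le> f x"
  proof (rule ccontr)
    assume "\<not> ?thesis"
    then have lt: "f x < norm f - e" if "norm x \<le> 1" for x
      using that by force
    have up: "f x \<le> (norm f - e) * norm x" for x
    proof (cases "x = 0")
      case False
      have "f (sgn x) < norm f - e" by (intro lt) (simp add: norm_sgn)
      then show ?thesis
        using False by (simp add: sgn_div_norm blinfun.bilinear_simps field_simps)
    qed simp
    have "norm f \<le> norm f - e"
    proof (rule norm_blinfun_bound)
      show "0 \<le> norm f - e" using lt[of 0] by simp
      show "norm (f x) \<le> (norm f - e) * norm x" for x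
        using up[of x] up[of "- x"] by (auto simp: blinfun.bilinear_simps)
    qed
    then show False using assms by simp
  qed
  then show thesis using that by blast
qed

text \<open>The dual of the supremum norm is the sum of the norms: almost norming vectors can be
  chosen for each \<open>h k\<close> independently.\<close>

lemma sum_norm_functionals_le:
  fixes h :: "nat \<Rightarrow> 'a::real_normed_vector \<Rightarrow>\<^sub>L real"
  assumes "\<And>v. (\<And>k. k < N \<Longrightarrow> norm (v k) \<le> 1) \<Longrightarrow> (\<Sum>k<N. h k (v k)) \<le> c"
  shows "(\<Sum>k<N. norm (h k)) \<le> c"
proof (rule field_le_epsilon)
  fix e :: real assume e: "0 < e"
  have "\<exists>x. norm x \<le> 1 \<and> norm (h k) - e / (N + 1) \<le> h k x" for k
    using functional_almost_norming[of "e / (N + 1)" "h k"] e by force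
  then obtain v where v: "\<And>k. norm (v k) \<le> 1" "\<And>k. norm (h k) - e / (N + 1) \<le> h k (v k)"
    by metis
  have "(\<Sum>k<N. norm (h k)) - N * (e / (N + 1)) = (\<Sum>k<N. norm (h k) - e / (N + 1))"
    by (simp add: sum_subtractf)
  also have "\<dots> \<le> (\<Sum>k<N. h k (v k))" by (intro sum_mono v)
  also have "\<dots> \<le> c" by (intro assms v)
  finally have "(\<Sum>k<N. norm (h k)) \<le> c + N * (e / (N + 1))" by simp
  also have "N * (e / (N + 1)) \<le> e" using e by (simp add: field_simps)
  finally show "(\<Sum>k<N. norm (h k)) \<le> c + e" by simp
qed

text \<open>The unit ball need not be totally bounded, but its image under finitely many functionals
  is: rounding the values down to multiples of \<open>e\<close> leaves finitely many cells, and one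
  point is kept from each.\<close>

lemma finite_net_functionals:
  fixes g :: "nat \<Rightarrow> 'a::real_normed_vector \<Rightarrow>\<^sub>L real"
  assumes e: "0 < e"
  obtains N :: nat and y where "\<And>k. k < N \<Longrightarrow> norm (y k) \<le> 1"
    "\<And>x. norm x \<le> 1 \<Longrightarrow> \<exists>k<N. \<forall>j<d. \<bar>g j x - g j (y k)\<bar> \<le> e"
proof -
  define c where "c x = map (\<lambda>j. \<lfloor>g j x / e\<rfloor>) [0..<d]" for x
  define M where "M = (\<Sum>j<d. norm (g j)) / e"
  have "c x \<in> {xs. set xs \<subseteq> {\<lfloor>- M\<rfloor>..\<lfloor>M\<rfloor>} \<and> length xs = d}" if "norm x \<le> 1" for x
  proof -
    have "\<lfloor>g j x / e\<rfloor> \<in> {\<lfloor>- M\<rfloor>..\<lfloor>M\<rfloor>}" if "j < d" for j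
    proof -
      have "\<bar>g j x\<bar> \<le> norm (g j) * norm x" using norm_blinfun[of "g j" x] by simp
      also have "\<dots> \<le> norm (g j)" using \<open>norm x \<le> 1\<close> by (simp add: mult_left_le)
      also have "\<dots> \<le> (\<Sum>j<d. norm (g j))" using that by (intro member_le_sum) auto
      finally have "\<bar>g j x / e\<bar> \<le> M" using e by (simp add: M_def divide_right_mono)
      then have "- M \<le> g j x / e" "g j x / e \<le> M" by linarith+
      then show ?thesis by (simp add: floor_mono)
    qed
    then show ?thesis by (auto simp: c_def)
  qed
  then have "c ` {x. norm x \<le> 1} \<subseteq> {xs. set xs \<subseteq> {\<lfloor>- M\<rfloor>..\<lfloor>M\<rfloor>} \<and> length xs = d}"
    by blast
  then have "finite (c ` {x. norm x \<le> 1})"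
    by (rule finite_subset) (intro finite_lists_length_eq finite_atLeastAtMost_int)
  then obtain Y where Y: "Y \<subseteq> {x. norm x \<le> 1}" "finite Y" "c ` {x. norm x \<le> 1} = c ` Y"
    using finite_subset_image[OF _ subset_refl] by metis
  obtain N y where Ny: "Y = y ` {i. i < (N::nat)}"
    using finite_imp_nat_seg_image_inj_on[OF Y(2)] by blast
  show thesis
  proof
    show "norm (y k) \<le> 1" if "k < N" for k
      using Y(1) Ny that by auto
    fix x :: 'a assume "norm x \<le> 1"
    then have "c x \<in> c ` Y" using Y(3) by blast
    then obtain k where k: "k < N" "c x = c (y k)" using Ny by auto
    have "\<bar>g j x - g j (y k)\<bar> \<le> e" if "j < d" for j
    proof -
      have "\<lfloor>g j x / e\<rfloor> = \<lfloor>g j (y k) / e\<rfloor>"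
        using k(2) that by (auto simp: c_def)
      then have "\<bar>g j x / e - g j (y k) / e\<bar> < 1" by linarith
      then have "\<bar>(g j x - g j (y k)) / e\<bar> < 1" by (simp add: diff_divide_distrib)
      then show ?thesis using e by simp
    qed
    with k show "\<exists>k<N. \<forall>j<d. \<bar>g j x - g j (y k)\<bar> \<le> e" by blast
  qed
qed

definition rank_one :: "('a::real_normed_vector \<Rightarrow>\<^sub>L real) \<Rightarrow> 'b::real_normed_vector \<Rightarrow> 'a \<Rightarrow>\<^sub>L 'b" where
  "rank_one g x = blinfun_scaleR_left x o\<^sub>L g"

lemma rank_one_apply [simp]: "rank_one g x y = g y *\<^sub>R x"
  by (simp add: rank_one_def)

text \<open>Since \<open>x j\<close> is the value of the operator at \<open>u j\<close>, moving to a
  net point costs at most half of the operator norm; absorbing this on the left gives the factor 2.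
  The net is independent of the \<open>x j\<close>.\<close>

lemma norm_sum_rank_one_le:
  fixes g :: "nat \<Rightarrow> 'a::real_normed_vector \<Rightarrow>\<^sub>L real" and x :: "nat \<Rightarrow> 'a"
  assumes dual: "\<And>i j. i < d \<Longrightarrow> j < d \<Longrightarrow> g i (u j) = (if i = j then 1 else 0)"
    and net: "\<And>z. norm z \<le> 1 \<Longrightarrow> \<exists>k<N. \<forall>j<d. \<bar>g j z - g j (y k)\<bar> \<le> e"
    and e: "e * (\<Sum>j<d. norm (u j)) \<le> 1 / 2" "0 \<le> e"
  shows "norm (\<Sum>j<d. rank_one (g j) (x j))
    \<le> 2 * norm (finseq N (\<lambda>k. \<Sum>j<d. g j (y k) *\<^sub>R x j))"
proof -
  define T where "T = (\<Sum>j<d. rank_one (g j) (x j))"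
  define M where "M = norm (finseq N (\<lambda>k. \<Sum>j<d. g j (y k) *\<^sub>R x j))"
  have T: "T z = (\<Sum>j<d. g j z *\<^sub>R x j)" for z
    by (simp add: T_def blinfun.sum_left)
  have Tu: "T (u j) = x j" if "j < d" for j
  proof -
    have "T (u j) = (\<Sum>i<d. if i = j then x j else 0)"
      unfolding T using dual that by (intro sum.cong) auto
    then show ?thesis using that by simp
  qed
  have bound: "norm (T z) \<le> M + norm T / 2" if z: "norm z \<le> 1" for z
  proof -
    obtain k where k: "k < N" "\<And>j. j < d \<Longrightarrow> \<bar>g j z - g j (y k)\<bar> \<le> e"
      using net[OF z] by blast
    have "norm (\<Sum>j<d. (g j z - g j (y k)) *\<^sub>R x j) \<le> (\<Sum>j<d. e * (norm T * norm (u j)))"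
    proof (rule sum_norm_le)
      fix j assume j: "j \<in> {..<d}"
      have "norm (x j) \<le> norm T * norm (u j)"
        using norm_blinfun[of T "u j"] Tu j by simp
      then show "norm ((g j z - g j (y k)) *\<^sub>R x j) \<le> e * (norm T * norm (u j))"
        using k(2)[of j] j e by (auto intro!: mult_mono)
    qed
    also have "\<dots> = norm T * (e * (\<Sum>j<d. norm (u j)))"
      by (simp add: sum_distrib_left ac_simps)
    also have "\<dots> \<le> norm T * (1 / 2)"
      using e by (intro mult_left_mono) auto
    finally have le: "norm (\<Sum>j<d. (g j z - g j (y k)) *\<^sub>R x j) \<le> norm T / 2" by simp
    have "norm (\<Sum>j<d. g j (y k) *\<^sub>R x j) \<le> M"
      unfolding M_def using norm_le_finseq[OF k(1), of "\<lambda>k. \<Sum>j<d. g j (y k) *\<^sub>R x j"] .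
    moreover have "T z = (\<Sum>j<d. g j (y k) *\<^sub>R x j) + (\<Sum>j<d. (g j z - g j (y k)) *\<^sub>R x j)"
      by (simp add: T sum_subtractf scaleR_diff_left)
    ultimately show ?thesis
      using le norm_triangle_ineq[of "\<Sum>j<d. g j (y k) *\<^sub>R x j" "\<Sum>j<d. (g j z - g j (y k)) *\<^sub>R x j"]
      by simp
  qed
  have M0: "0 \<le> M" by (simp add: M_def)
  have "norm T \<le> M + norm T / 2"
  proof (rule norm_blinfun_bound)
    show "0 \<le> M + norm T / 2" using M0 by simp
    fix z
    show "norm (T z) \<le> (M + norm T / 2) * norm z"
    proof (cases "z = 0")
      case False
      have "norm (T (sgn z)) \<le> M + norm T / 2" by (rule bound) (simp add: norm_sgn)
      then show ?thesis
        using False by (simp add: sgn_div_norm blinfun.bilinear_simps field_simps)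
    qed simp
  qed
  then show ?thesis by (simp add: T_def M_def)
qed

text \<open>The finite-rank case of the principle of local reflexivity: a tuple of functionals controlled
  by the operator norm of \<open>\<Sum>g\<^sub>j \<otimes> x\<^sub>j\<close> for \<open>x\<^sub>j\<close> in the space is equally controlled, up to the
  factor \<open>2\<close>, when the \<open>x\<^sub>j\<close> are replaced by the bidual elements \<open>h \<mapsto> B h u\<^sub>j\<close>.  By Hahn--Banach
  and the choice of a finite norming set \<open>y\<^sub>k\<close>, one has \<open>h\<^sub>j = \<Sum>g\<^sub>j(y\<^sub>k) \<kappa>\<^sub>k\<close> with
  \<open>\<Sum>\<parallel>\<kappa>\<^sub>k\<parallel> \<le> 2 c\<close>.\<close>

lemma local_reflexivity_estimate:
  fixes g :: "nat \<Rightarrow> 'a::real_normed_vector \<Rightarrow>\<^sub>L real" and h :: "nat \<Rightarrow> 'a \<Rightarrow>\<^sub>L real"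
    and B :: "('a \<Rightarrow>\<^sub>L real) \<Rightarrow>\<^sub>L ('a \<Rightarrow>\<^sub>L real)"
  assumes dual: "\<And>i j. i < d \<Longrightarrow> j < d \<Longrightarrow> g i (u j) = (if i = j then 1 else 0)"
    and rep: "\<And>f. B f = (\<Sum>j<d. B f (u j) *\<^sub>R g j)"
    and c: "0 \<le> c"
    and h: "\<And>x. (\<Sum>j<d. h j (x j)) \<le> c * norm (\<Sum>j<d. rank_one (g j) (x j))"
  shows "(\<Sum>j<d. B (h j) (u j)) \<le> 2 * c * norm B"
proof -
  define s where "s = (\<Sum>j<d. norm (u j))"
  \<comment> \<open>Small enough for \<open>e * s\<close> to be at most 1/2, as the norming estimate
    asks; \<open>s + 1\<close> excludes division by zero.\<close>
  define e where "e = 1 / (2 * (s + 1))"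
  have s0: "0 \<le> s" by (simp add: s_def sum_nonneg)
  then have e: "0 < e" "e * (\<Sum>j<d. norm (u j)) \<le> 1 / 2"
    by (auto simp: e_def field_simps simp flip: s_def)
  obtain N and y :: "nat \<Rightarrow> 'a" where y: "\<And>k. k < N \<Longrightarrow> norm (y k) \<le> 1"
    and net: "\<And>x. norm x \<le> 1 \<Longrightarrow> \<exists>k<N. \<forall>j<d. \<bar>g j x - g j (y k)\<bar> \<le> e"
    using finite_net_functionals[OF e(1)] by metis
  define v where "v x = finseq N (\<lambda>k. \<Sum>j<d. g j (y k) *\<^sub>R x j)" for x :: "nat \<Rightarrow> 'a"
  \<comment> \<open>The graph of the map from \<open>v x\<close> to
    \<open>\<Sum>j<d. h j (x j)\<close>. By the norming property of the \<open>y k\<close> it is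
    dominated by \<open>2 * c\<close> times the norm, so it extends to all tuples.\<close>
  define G where "G = range (\<lambda>x. (v x, \<Sum>j<d. h j (x j)))"
  have v_add: "v (\<lambda>j. x j + x' j) = v x + v x'" for x x'
    unfolding v_def by (simp add: scaleR_add_right sum.distrib flip: finseq_add)
  have v_scale: "v (\<lambda>j. t *\<^sub>R x j) = t *\<^sub>R v x" for x t
    unfolding v_def by (simp add: scaleR_sum_right ac_simps flip: finseq_scaleR)
  have "subspace G"
    unfolding subspace_def
  proof (intro conjI ballI allI)
    have "v (\<lambda>_. 0) = 0" using v_scale[of 0] by simp
    then show "0 \<in> G"
      unfolding G_def by (intro image_eqI[of _ _ "\<lambda>_. 0"]) (auto simp: zero_prod_def)
  next
    fix a b assume "a \<in> G" "b \<in> G"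
    then obtain x x' where "a = (v x, \<Sum>j<d. h j (x j))" "b = (v x', \<Sum>j<d. h j (x' j))"
      by (auto simp: G_def)
    then show "a + b \<in> G"
      unfolding G_def
      by (intro image_eqI[of _ _ "\<lambda>j. x j + x' j"])
        (auto simp: v_add blinfun.add_right sum.distrib)
  next
    fix t a assume "a \<in> G"
    then obtain x where "a = (v x, \<Sum>j<d. h j (x j))"
      by (auto simp: G_def)
    then show "t *\<^sub>R a \<in> G"
      unfolding G_def
      by (intro image_eqI[of _ _ "\<lambda>j. t *\<^sub>R x j"])
        (auto simp: v_scale blinfun.scaleR_right sum_distrib_left)
  qed
  moreover have "r \<le> 2 * c * norm z" if "(z, r) \<in> G" for z r
  proof -
    obtain x where x: "z = v x" "r = (\<Sum>j<d. h j (x j))"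
      using \<open>(z, r) \<in> G\<close> by (auto simp: G_def)
    have "norm (\<Sum>j<d. rank_one (g j) (x j)) \<le> 2 * norm (v x)"
      unfolding v_def using e by (intro norm_sum_rank_one_le[OF dual net]) auto
    then have "c * norm (\<Sum>j<d. rank_one (g j) (x j)) \<le> c * (2 * norm (v x))"
      using c by (rule mult_left_mono)
    then show ?thesis using h[of x] by (simp add: x)
  qed
  ultimately obtain F where F: "norm F \<le> 2 * c" "\<And>z r. (z, r) \<in> G \<Longrightarrow> blinfun_apply F z = r"
    using hahn_banach_norm[of G "2 * c"] c by auto
  obtain \<kappa> where \<kappa>: "\<And>w. F (finseq N w) = (\<Sum>k<N. blinfun_apply (\<kappa> k) (w k))"
    using functional_on_finseq by blast
  have norm\<kappa>: "(\<Sum>k<N. norm (\<kappa> k)) \<le> 2 * c"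
  proof (rule sum_norm_functionals_le)
    fix w :: "nat \<Rightarrow> 'a" assume "\<And>k. k < N \<Longrightarrow> norm (w k) \<le> 1"
    then have "norm (finseq N w) \<le> 1" by (intro norm_finseq_le) auto
    then have "norm F * norm (finseq N w) \<le> 2 * c * 1"
      using F(1) c by (intro mult_mono) auto
    then show "(\<Sum>k<N. \<kappa> k (w k)) \<le> 2 * c"
      using norm_blinfun[of F "finseq N w"] by (simp flip: \<kappa>)
  qed
  have h\<kappa>: "h i = (\<Sum>k<N. g i (y k) *\<^sub>R \<kappa> k)" if i: "i < d" for i
  proof (rule blinfun_eqI)
    fix x :: 'a
    \<comment> \<open>Supported at the coordinate \<open>i\<close>, this tuple isolates
      \<open>h i\<close>.\<close>
    define X where "X j = (if j = i then x else 0)" for j :: nat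
    have "(\<Sum>j<d. h j (X j)) = (\<Sum>j<d. if j = i then h i x else 0)"
      unfolding X_def by (intro sum.cong) auto
    then have "h i x = (\<Sum>j<d. h j (X j))" using i by simp
    also have "\<dots> = F (v X)" by (rule F(2)[symmetric]) (simp add: G_def)
    also have "\<dots> = (\<Sum>k<N. \<kappa> k (\<Sum>j<d. g j (y k) *\<^sub>R X j))" by (simp add: v_def \<kappa>)
    also have "\<dots> = (\<Sum>k<N. \<kappa> k (g i (y k) *\<^sub>R x))"
    proof (intro sum.cong refl arg_cong[where f = "blinfun_apply (\<kappa> _)"])
      fix k
      have "(\<Sum>j<d. g j (y k) *\<^sub>R X j) = (\<Sum>j<d. if j = i then g i (y k) *\<^sub>R x else 0)"
        unfolding X_def by (intro sum.cong) auto
      then show "(\<Sum>j<d. g j (y k) *\<^sub>R X j) = g i (y k) *\<^sub>R x" using i by simp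
    qed
    finally show "h i x = (\<Sum>k<N. g i (y k) *\<^sub>R \<kappa> k) x"
      by (simp add: blinfun.sum_left blinfun.bilinear_simps)
  qed
  \<comment> \<open>After inserting \<open>h\<kappa>\<close> and summing over \<open>j\<close>
    first, \<open>rep\<close> reassembles \<open>B (\<kappa> k)\<close> at \<open>y k\<close>: the
    points \<open>u j\<close> disappear, and only points of the unit ball remain.\<close>
  have "(\<Sum>j<d. B (h j) (u j)) = (\<Sum>j<d. \<Sum>k<N. g j (y k) * B (\<kappa> k) (u j))"
    by (intro sum.cong refl) (simp add: h\<kappa> blinfun.bilinear_simps blinfun.sum_left blinfun.sum_right)
  also have "\<dots> = (\<Sum>k<N. \<Sum>j<d. g j (y k) * B (\<kappa> k) (u j))"
    by (rule sum.swap)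
  also have "\<dots> = (\<Sum>k<N. B (\<kappa> k) (y k))"
  proof (intro sum.cong refl)
    fix k
    have "B (\<kappa> k) (y k) = (\<Sum>j<d. B (\<kappa> k) (u j) *\<^sub>R g j) (y k)"
      using rep[of "\<kappa> k"] by metis
    then show "(\<Sum>j<d. g j (y k) * B (\<kappa> k) (u j)) = B (\<kappa> k) (y k)"
      by (simp add: blinfun.sum_left blinfun.bilinear_simps mult.commute)
  qed
  also have "\<dots> \<le> (\<Sum>k<N. norm B * norm (\<kappa> k))"
  proof (rule sum_mono)
    fix k assume "k \<in> {..<N}"
    then have "norm (y k) \<le> 1" using y by simp
    have "B (\<kappa> k) (y k) \<le> norm (B (\<kappa> k)) * norm (y k)"
      using norm_blinfun[of "B (\<kappa> k)" "y k"] by simp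
    also have "\<dots> \<le> norm (B (\<kappa> k)) * 1"
      using \<open>norm (y k) \<le> 1\<close> by (intro mult_left_mono) auto
    also have "\<dots> \<le> norm B * norm (\<kappa> k)"
      using norm_blinfun[of B "\<kappa> k"] by simp
    finally show "B (\<kappa> k) (y k) \<le> norm B * norm (\<kappa> k)" .
  qed
  also have "\<dots> \<le> norm B * (2 * c)"
    unfolding sum_distrib_left[symmetric] using norm\<kappa> by (intro mult_left_mono) auto
  finally show ?thesis by (simp add: ac_simps)
qed

section \<open>Separation argument for simultaneous approximation\<close>

text \<open>Phrased as a span rather than by the range, so that membership hands over the rank one
  terms from which the frame is built.\<close>

abbreviation finite_rank_operators :: "('a::real_normed_vector \<Rightarrow>\<^sub>L 'a) set" where
  "finite_rank_operators \<equiv> span {rank_one g x | g x. True}"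

lemma approximate_by_adjoints:
  fixes B :: "nat \<Rightarrow> ('a::banach \<Rightarrow>\<^sub>L real) \<Rightarrow>\<^sub>L ('a \<Rightarrow>\<^sub>L real)"
    and x :: "nat \<Rightarrow> 'a" and f :: "nat \<Rightarrow> 'a \<Rightarrow>\<^sub>L real"
  assumes fin: "\<And>n. finite_rank (B n)" and lim: "\<And>f. (\<lambda>n. B n f) \<longlonglongrightarrow> f"
    and C: "\<And>n. norm (B n) \<le> C" and e: "0 < e"
  obtains T where "T \<in> finite_rank_operators" "norm T \<le> 4 * (C + 1)"
    "\<And>k. k < m \<Longrightarrow> norm (x k - T (x k)) < e" "\<And>k. k < m \<Longrightarrow> norm (f k - (f k o\<^sub>L T)) < e"
proof -
  define c where "c = 4 * (C + 1)"
  have C0: "0 \<le> C" using C[of 0] norm_ge_zero order_trans by blast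
  then have c: "0 < c" by (simp add: c_def)
  define L where "L T = (finseq m (\<lambda>k. T (x k)), finseq m (\<lambda>k. f k o\<^sub>L T))" for T :: "'a \<Rightarrow>\<^sub>L 'a"
  define v where "v = (finseq m x, finseq m f)"
  have linL: "linear L"
    unfolding L_def
    by (rule linearI)
      (auto simp: blinfun.bilinear_simps bounded_bilinear.add_right[OF bounded_bilinear_blinfun_compose]
        bounded_bilinear.scaleR_right[OF bounded_bilinear_blinfun_compose] finseq_add finseq_scaleR)
  have "\<exists>T \<in> finite_rank_operators. norm T \<le> c \<and> norm (v - L T) < e"
  proof (rule ccontr)
    assume "\<not> ?thesis"
    then have far: "\<And>T. T \<in> finite_rank_operators \<Longrightarrow> norm T \<le> c \<Longrightarrow> e \<le> norm (v - L T)"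
      by force
    obtain F where Fv: "1 \<le> blinfun_apply F v"
      and FL: "\<And>T. T \<in> finite_rank_operators \<Longrightarrow> blinfun_apply F (L T) \<le> norm T / c"
      using separate_from_linear_image[OF subspace_span linL e c far] by blast
    define F1 where "F1 = F o\<^sub>L Blinfun (\<lambda>z. (z, 0))"
    define F2 where "F2 = F o\<^sub>L Blinfun (\<lambda>z. (0, z))"
    have Fsplit: "F (z, w) = F1 z + F2 w" for z w
    proof -
      have "bounded_linear (\<lambda>z::nat \<Rightarrow>\<^sub>C 'a. (z, 0::nat \<Rightarrow>\<^sub>C ('a \<Rightarrow>\<^sub>L real)))"
        "bounded_linear (\<lambda>z::nat \<Rightarrow>\<^sub>C ('a \<Rightarrow>\<^sub>L real). (0::nat \<Rightarrow>\<^sub>C 'a, z))"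
        by (intro bounded_linear_Pair bounded_linear_ident bounded_linear_zero)+
      moreover have "(z, w) = (z, 0) + (0, w)" by simp
      ultimately show ?thesis
        unfolding F1_def F2_def
        by (simp add: bounded_linear_Blinfun_apply blinfun.add_right[symmetric])
    qed
    obtain h where h: "\<And>w. F1 (finseq m w) = (\<Sum>k<m. blinfun_apply (h k) (w k))"
      using functional_on_finseq by blast
    obtain \<phi> where \<phi>: "\<And>w. F2 (finseq m w) = (\<Sum>k<m. blinfun_apply (\<phi> k) (w k))"
      using functional_on_finseq by blast
    \<comment> \<open>The separating functional at the data moved by \<open>B n\<close>: the number
      \<open>B n (h k) (x k)\<close> pairs \<open>h k\<close> with the bidual element that the
      adjoint of \<open>B n\<close> makes of \<open>x k\<close>.\<close>
    have "(\<lambda>n. (\<Sum>k<m. B n (h k) (x k)) + (\<Sum>k<m. \<phi> k (B n (f k))))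
        \<longlonglongrightarrow> (\<Sum>k<m. h k (x k)) + (\<Sum>k<m. \<phi> k (f k))"
      by (intro tendsto_add tendsto_sum blinfun.tendsto tendsto_const lim)
    moreover have "(\<Sum>k<m. h k (x k)) + (\<Sum>k<m. \<phi> k (f k)) > 1 / 2"
      using Fv by (simp add: v_def Fsplit h \<phi>)
    ultimately have "\<forall>\<^sub>F n in sequentially. (\<Sum>k<m. B n (h k) (x k)) + (\<Sum>k<m. \<phi> k (B n (f k))) > 1 / 2"
      by (rule order_tendstoD(1))
    then obtain n where n: "(\<Sum>k<m. B n (h k) (x k)) + (\<Sum>k<m. \<phi> k (B n (f k))) > 1 / 2"
      unfolding eventually_sequentially by blast
    obtain A where A: "finite A" "range (blinfun_apply (B n)) \<subseteq> span A"
      using fin[of n] by (auto simp: finite_rank_def finite_dim_set_def)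
    obtain d :: nat and g :: "nat \<Rightarrow> 'a \<Rightarrow>\<^sub>L real" and u
      where dual: "\<And>i j. i < d \<Longrightarrow> j < d \<Longrightarrow> g i (u j) = (if i = j then 1 else 0)"
        and repA: "\<And>f. f \<in> span A \<Longrightarrow> f = (\<Sum>j<d. blinfun_apply f (u j) *\<^sub>R g j)"
      using finite_span_dual_basis[OF A(1)] by blast
    have rep: "B n f = (\<Sum>j<d. B n f (u j) *\<^sub>R g j)" for f
      using A(2) by (intro repA) blast
    \<comment> \<open>The functional in tensor coordinates: on the operator
      \<open>\<Sum>j<d. rank_one (g j) (y j)\<close> its value is
      \<open>\<Sum>j<d. h' j (y j)\<close>. Putting \<open>B n (h' j) (u j)\<close> for
      \<open>h' j (y j)\<close> gives its value on the data moved by \<open>B n\<close>.\<close>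
    define h' where "h' j = (\<Sum>k<m. g j (x k) *\<^sub>R h k) + (\<Sum>k<m. \<phi> k (g j) *\<^sub>R f k)" for j
    have "(\<Sum>j<d. B n (h' j) (u j)) \<le> 2 * (1 / c) * norm (B n)"
    proof (rule local_reflexivity_estimate[OF dual rep])
      show "0 \<le> 1 / c" using c by simp
      fix y :: "nat \<Rightarrow> 'a"
      define T where "T = (\<Sum>j<d. rank_one (g j) (y j))"
      have Tx: "T z = (\<Sum>j<d. g j z *\<^sub>R y j)" for z
        by (simp add: T_def blinfun.sum_left)
      have Tf: "q o\<^sub>L T = (\<Sum>j<d. q (y j) *\<^sub>R g j)" for q :: "'a \<Rightarrow>\<^sub>L real"
        by (rule blinfun_eqI)
          (simp add: Tx blinfun.sum_left blinfun.sum_right blinfun.bilinear_simps mult.commute)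
      have "T \<in> finite_rank_operators"
        unfolding T_def by (intro span_sum span_base) blast
      then have "F (L T) \<le> norm T / c" by (rule FL)
      moreover have "F (L T) = (\<Sum>j<d. h' j (y j))"
      proof -
        have "(\<Sum>k<m. h k (T (x k))) = (\<Sum>k<m. \<Sum>j<d. g j (x k) * h k (y j))"
          by (simp add: Tx blinfun.sum_right blinfun.scaleR_right)
        also have "\<dots> = (\<Sum>j<d. \<Sum>k<m. g j (x k) * h k (y j))" by (rule sum.swap)
        finally have 1: "(\<Sum>k<m. h k (T (x k))) = (\<Sum>j<d. \<Sum>k<m. g j (x k) * h k (y j))" .
        have "(\<Sum>k<m. \<phi> k (f k o\<^sub>L T)) = (\<Sum>k<m. \<Sum>j<d. \<phi> k (g j) * f k (y j))"
          by (simp add: Tf blinfun.sum_right blinfun.scaleR_right mult.commute)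
        also have "\<dots> = (\<Sum>j<d. \<Sum>k<m. \<phi> k (g j) * f k (y j))" by (rule sum.swap)
        finally have 2: "(\<Sum>k<m. \<phi> k (f k o\<^sub>L T)) = (\<Sum>j<d. \<Sum>k<m. \<phi> k (g j) * f k (y j))" .
        show ?thesis
          unfolding L_def Fsplit h \<phi> 1 2 h'_def
          by (simp add: blinfun.add_left blinfun.sum_left blinfun.scaleR_left sum.distrib)
      qed
      ultimately show "(\<Sum>j<d. h' j (y j)) \<le> 1 / c * norm (\<Sum>j<d. rank_one (g j) (y j))"
        by (simp add: T_def)
    qed
    moreover have "(\<Sum>j<d. B n (h' j) (u j))
        = (\<Sum>k<m. B n (h k) (x k)) + (\<Sum>k<m. \<phi> k (B n (f k)))"
    proof -
      have "(\<Sum>j<d. \<Sum>k<m. g j (x k) * B n (h k) (u j)) = (\<Sum>k<m. \<Sum>j<d. g j (x k) * B n (h k) (u j))"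
        by (rule sum.swap)
      also have "\<dots> = (\<Sum>k<m. B n (h k) (x k))"
      proof (intro sum.cong refl)
        fix k
        have "B n (h k) (x k) = (\<Sum>j<d. B n (h k) (u j) *\<^sub>R g j) (x k)"
          using rep[of "h k"] by metis
        then show "(\<Sum>j<d. g j (x k) * B n (h k) (u j)) = B n (h k) (x k)"
          by (simp add: blinfun.sum_left blinfun.bilinear_simps mult.commute)
      qed
      finally have 1: "(\<Sum>j<d. \<Sum>k<m. g j (x k) * B n (h k) (u j)) = (\<Sum>k<m. B n (h k) (x k))" .
      have "(\<Sum>j<d. \<Sum>k<m. \<phi> k (g j) * B n (f k) (u j)) = (\<Sum>k<m. \<Sum>j<d. \<phi> k (g j) * B n (f k) (u j))"
        by (rule sum.swap)
      also have "\<dots> = (\<Sum>k<m. \<phi> k (B n (f k)))"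
      proof (intro sum.cong refl)
        fix k
        have "\<phi> k (B n (f k)) = \<phi> k (\<Sum>j<d. B n (f k) (u j) *\<^sub>R g j)"
          using rep[of "f k"] by metis
        then show "(\<Sum>j<d. \<phi> k (g j) * B n (f k) (u j)) = \<phi> k (B n (f k))"
          by (simp add: blinfun.sum_right blinfun.scaleR_right mult.commute)
      qed
      finally have 2: "(\<Sum>j<d. \<Sum>k<m. \<phi> k (g j) * B n (f k) (u j)) = (\<Sum>k<m. \<phi> k (B n (f k)))" .
      show ?thesis
        unfolding 1[symmetric] 2[symmetric] h'_def
        by (simp add: blinfun.bilinear_simps blinfun.sum_left blinfun.sum_right sum.distrib)
    qed
    moreover have "2 * (1 / c) * norm (B n) \<le> 1 / 2"
      using C[of n] C0 by (simp add: c_def field_simps)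
    ultimately show False using n by linarith
  qed
  then obtain T where T: "T \<in> finite_rank_operators" "norm T \<le> c" "norm (v - L T) < e" by blast
  have split: "v - L T = (finseq m (\<lambda>k. x k - T (x k)), finseq m (\<lambda>k. f k - (f k o\<^sub>L T)))"
    by (simp add: v_def L_def finseq_diff)
  show thesis
  proof
    show "T \<in> finite_rank_operators" "norm T \<le> 4 * (C + 1)" using T by (auto simp: c_def)
    show "norm (x k - T (x k)) < e" if "k < m" for k
      using norm_le_finseq[OF that, of "\<lambda>k. x k - T (x k)"] norm_fst_le[of "fst (v - L T)" "snd (v - L T)"] T(3)
      by (simp add: split)
    show "norm (f k - (f k o\<^sub>L T)) < e" if "k < m" for k
      using norm_le_finseq[OF that, of "\<lambda>k. f k - (f k o\<^sub>L T)"] norm_snd_le[of "snd (v - L T)" "fst (v - L T)"] T(3)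
      by (simp add: split)
  qed
qed

section \<open>Approximation by finite rank operators\<close>

lemma tendsto_from_dense:
  fixes S :: "nat \<Rightarrow> 'a::real_normed_vector \<Rightarrow> 'a"
  assumes diff: "\<And>n x y. S n (x - y) = S n x - S n y"
    and bound: "\<And>n x. norm (S n x) \<le> C * norm x"
    and dense: "closure D = UNIV" and lim: "\<And>x. x \<in> D \<Longrightarrow> (\<lambda>n. S n x) \<longlonglongrightarrow> x"
  shows "(\<lambda>n. S n x) \<longlonglongrightarrow> x"
proof (rule LIMSEQ_I)
  fix e :: real assume e: "0 < e"
  \<comment> \<open>Positive and above \<open>C + 1\<close>, so that a point within
    \<open>e / (2 * c)\<close> accounts for at most \<open>e / 2\<close> of the error.\<close>
  define c where "c = \<bar>C\<bar> + 2"
  have c: "0 < c" "C + 1 < c" by (auto simp: c_def)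
  obtain z where z: "z \<in> D" "dist z x < e / (2 * c)"
    using dense e c(1) closure_approachable[of x D]
    by (metis UNIV_I divide_pos_pos mult_pos_pos zero_less_numeral)
  obtain N where N: "\<And>n. N \<le> n \<Longrightarrow> norm (S n z - z) < e / 2"
    using LIMSEQ_D[OF lim[OF z(1)], of "e / 2"] e by auto
  have "norm (S n x - x) < e" if "N \<le> n" for n
  proof -
    have eq: "S n x - x = S n (x - z) + (S n z - z) + (z - x)"
      by (simp add: diff)
    have "norm (S n x - x) \<le> norm (S n (x - z)) + norm (S n z - z) + norm (z - x)"
      unfolding eq using norm_triangle_ineq[of "S n (x - z) + (S n z - z)" "z - x"]
        norm_triangle_ineq[of "S n (x - z)" "S n z - z"] by linarith
    also have "\<dots> \<le> (C + 1) * norm (z - x) + norm (S n z - z)"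
      using bound[of n "x - z"] by (simp add: norm_minus_commute algebra_simps)
    also have "\<dots> < c * (e / (2 * c)) + e / 2"
      using N[OF that] z(2) c
      by (intro add_le_less_mono mult_mono) (auto simp: dist_norm)
    also have "\<dots> = e" using c by simp
    finally show ?thesis .
  qed
  then show "\<exists>N. \<forall>n\<ge>N. norm (S n x - x) < e" by blast
qed

lemma separable_euclidean_dense_sequence:
  assumes "separable_space (euclidean :: 'a topology)"
  obtains d :: "nat \<Rightarrow> 'a::topological_space" where "closure (range d) = UNIV"
proof -
  obtain D :: "'a set" where D: "countable D" "closure D = UNIV"
    using assms by (auto simp: separable_space_def)
  then have "D \<noteq> {}" by auto
  then obtain d :: "nat \<Rightarrow> 'a" where "range d = D"
    using D(1) by (metis range_from_nat_into)
  then show thesis using that D(2) by blast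
qed

text \<open>The \<open>n\<close>-th operator is accurate to \<open>1 / (n + 1)\<close> on the first
  \<open>n\<close> members of dense sequences in the space and in the dual; the common norm bound
  carries convergence to the closures.\<close>

lemma approximating_operators:
  assumes sep: "separable_space (euclidean :: 'a::banach topology)"
    "separable_space (euclidean :: ('a \<Rightarrow>\<^sub>L real) topology)"
    and bap: "bounded_approximation_property TYPE('a \<Rightarrow>\<^sub>L real)"
  shows "\<exists>T :: nat \<Rightarrow> 'a \<Rightarrow>\<^sub>L 'a. (\<forall>n. T n \<in> finite_rank_operators) \<and>
    (\<forall>x. (\<lambda>n. T n x) \<longlonglongrightarrow> x) \<and> (\<forall>f :: 'a \<Rightarrow>\<^sub>L real. (\<lambda>n. f o\<^sub>L T n) \<longlonglongrightarrow> f)"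
proof -
  obtain B :: "nat \<Rightarrow> ('a \<Rightarrow>\<^sub>L real) \<Rightarrow>\<^sub>L ('a \<Rightarrow>\<^sub>L real)"
    where fin: "\<And>n. finite_rank (B n)" and nlim: "\<And>f. (\<lambda>n. norm (f - B n f)) \<longlonglongrightarrow> 0"
    using bap unfolding bounded_approximation_property_def by blast
  have lim: "(\<lambda>n. B n f) \<longlonglongrightarrow> f" for f
    using tendsto_diff[OF tendsto_const[of f] tendsto_norm_zero_cancel[OF nlim[of f]]] by simp
  obtain C where C: "\<And>n. norm (B n) \<le> C"
    using uniform_boundedness[of B] lim by (meson convergentI convergent_imp_Bseq)
  obtain x :: "nat \<Rightarrow> 'a" where x: "closure (range x) = UNIV"
    using separable_euclidean_dense_sequence[OF sep(1)] .
  obtain f :: "nat \<Rightarrow> 'a \<Rightarrow>\<^sub>L real" where f: "closure (range f) = UNIV"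
    using separable_euclidean_dense_sequence[OF sep(2)] .
  define c where "c = 4 * (C + 1)"
  define good where "good n T \<longleftrightarrow> T \<in> finite_rank_operators \<and> norm T \<le> c \<and>
      (\<forall>k<n. norm (x k - T (x k)) < inverse (real (Suc n))) \<and>
      (\<forall>k<n. norm (f k - (f k o\<^sub>L T)) < inverse (real (Suc n)))" for n and T :: "'a \<Rightarrow>\<^sub>L 'a"
  have "\<exists>T. good n T" for n
    unfolding good_def c_def
    by (rule approximate_by_adjoints[where e = "inverse (real (Suc n))" and m = n and x = x and f = f,
          OF fin lim C]) auto
  then obtain T where good: "\<And>n. good n (T n)" by metis
  have T: "T n \<in> finite_rank_operators" "norm (T n) \<le> c"
      "k < n \<Longrightarrow> norm (x k - T n (x k)) < inverse (real (Suc n))"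
      "k < n \<Longrightarrow> norm (f k - (f k o\<^sub>L T n)) < inverse (real (Suc n))" for n k
    using good[of n] by (auto simp: good_def)
  have conv: "a \<longlonglongrightarrow> l" if "\<And>n. k < n \<Longrightarrow> norm (l - a n) < inverse (real (Suc n))"
    for a :: "nat \<Rightarrow> 'w::real_normed_vector" and l k
  proof -
    have "\<forall>\<^sub>F n in sequentially. norm (a n - l) \<le> inverse (real (Suc n))"
      using eventually_gt_at_top[of k]
      by eventually_elim (metis less_imp_le norm_minus_commute that)
    then have "(\<lambda>n. a n - l) \<longlonglongrightarrow> 0"
      by (rule Lim_null_comparison) (rule LIMSEQ_inverse_real_of_nat)
    then show ?thesis by (simp add: LIM_zero_iff)
  qed
  have xlim: "(\<lambda>n. T n (x k)) \<longlonglongrightarrow> x k" and flim: "(\<lambda>n. f k o\<^sub>L T n) \<longlonglongrightarrow> f k" for k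
    using T(3,4) by (auto intro!: conv[of k])
  have Tx: "norm (T n y) \<le> c * norm y" for n y
    using order_trans[OF norm_blinfun mult_right_mono[OF T(2)]] by simp
  have Tf: "norm (g o\<^sub>L T n) \<le> c * norm g" for n and g :: "'a \<Rightarrow>\<^sub>L real"
  proof -
    have "norm (g o\<^sub>L T n) \<le> norm g * norm (T n)" by (rule norm_blinfun_compose)
    also have "\<dots> \<le> norm g * c" using T(2) by (intro mult_left_mono) auto
    finally show ?thesis by (simp add: mult.commute)
  qed
  show ?thesis
  proof (intro exI[of _ T] conjI allI)
    show "T n \<in> finite_rank_operators" for n by (rule T)
    show "(\<lambda>n. T n y) \<longlonglongrightarrow> y" for y
      by (rule tendsto_from_dense[where S = "\<lambda>n. blinfun_apply (T n)", OF blinfun.diff_right Tx x])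
        (use xlim in auto)
    show "(\<lambda>n. g o\<^sub>L T n) \<longlonglongrightarrow> g" for g :: "'a \<Rightarrow>\<^sub>L real"
      by (rule tendsto_from_dense[where S = "\<lambda>n g. g o\<^sub>L T n",
            OF bounded_bilinear.diff_left[OF bounded_bilinear_blinfun_compose] Tf f])
        (use flim in auto)
  qed
qed

section \<open>Shrinking frames\<close>

text \<open>With \<open>x0\<close> the zero operator becomes one term with zero functional, so no
  sum is empty and no vector vanishes: a frame forbids zero vectors but allows zero
  functionals.\<close>

lemma finite_rank_operator_sum:
  fixes x0 :: "'a::real_normed_vector"
  assumes "A \<in> finite_rank_operators" "x0 \<noteq> 0"
  shows "\<exists>d (g :: nat \<Rightarrow> 'a \<Rightarrow>\<^sub>L real) y. 0 < (d::nat) \<and> (\<forall>j. y j \<noteq> 0) \<and>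
    A = (\<Sum>j<d. rank_one (g j) (y j))"
  using assms(1)
proof (induction rule: span_induct_alt)
  case base
  have "(0 :: 'a \<Rightarrow>\<^sub>L 'a) = (\<Sum>j<1::nat. rank_one 0 x0)"
    by (rule blinfun_eqI) simp
  then show ?case
    using assms(2) by (intro exI[of _ "1 :: nat"] exI[of _ "\<lambda>_. 0"] exI[of _ "\<lambda>_. x0"]) simp
next
  case (step c R A)
  then obtain d g y where A: "0 < (d::nat)" "\<And>j. y j \<noteq> 0" "A = (\<Sum>j<d. rank_one (g j) (y j))"
    by blast
  obtain f z where R: "R = rank_one f z" using step by blast
  show ?case
  proof (cases "z = 0")
    case True
    then have "c *\<^sub>R R + A = A" by (intro blinfun_eqI) (simp add: R blinfun.bilinear_simps)
    then have "c *\<^sub>R R + A = (\<Sum>j<d. rank_one (g j) (y j))" using A(3) by simp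
    then show ?thesis using A(1,2) by blast
  next
    case False
    have "(\<Sum>j<Suc d. rank_one ((g(d := c *\<^sub>R f)) j) ((y(d := z)) j)) = A + rank_one (c *\<^sub>R f) z"
      by (simp add: A(3))
    also have "\<dots> = c *\<^sub>R R + A"
      by (rule blinfun_eqI) (simp add: R blinfun.bilinear_simps)
    finally have "c *\<^sub>R R + A = (\<Sum>j<Suc d. rank_one ((g(d := c *\<^sub>R f)) j) ((y(d := z)) j))" ..
    moreover have "\<forall>j. (y(d := z)) j \<noteq> 0" using A(2) False by simp
    ultimately show ?thesis by blast
  qed
qed

lemma sum_mod_periodic:
  fixes F :: "nat \<Rightarrow> 'v::real_vector"
  assumes "b \<le> d"
  shows "(\<Sum>i<a * d + b. F (i mod d)) = real a *\<^sub>R (\<Sum>i<d. F i) + (\<Sum>i<b. F i)"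
proof -
  \<comment> \<open>The case \<open>b = d\<close> completes a round and drives the induction on
    \<open>a\<close>.\<close>
  have step: "(\<Sum>i<a * d + b. F (i mod d)) = (\<Sum>i<a * d. F (i mod d)) + (\<Sum>i<b. F i)"
    if "b \<le> d" for a b
    using that by (induction b) (auto simp: add.assoc)
  have "(\<Sum>i<a * d. F (i mod d)) = real a *\<^sub>R (\<Sum>i<d. F i)"
  proof (induction a)
    case (Suc a)
    then show ?case using step[of d a] by (simp add: add.commute scaleR_add_left)
  qed simp
  then show ?thesis using step[OF assms] by simp
qed

text \<open>Running \<open>m\<close> times through the rank-one summands of \<open>A\<close>, each with weight \<open>1 / m\<close>, keeps all
  partial sums within \<open>e\<close> of a multiple \<open>t A\<close> with \<open>0 \<le> t \<le> 1\<close>.\<close>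

lemma rank_one_block:
  fixes x0 :: "'a::real_normed_vector"
  assumes A: "A \<in> finite_rank_operators" and x0: "x0 \<noteq> 0" and e: "0 < e"
  shows "\<exists>l (q :: nat \<Rightarrow> 'a \<times> ('a \<Rightarrow>\<^sub>L real)). 0 < l \<and> (\<forall>i. fst (q i) \<noteq> 0) \<and>
    (\<Sum>i<l. rank_one (snd (q i)) (fst (q i))) = A \<and>
    (\<forall>k<l. \<exists>t. 0 \<le> t \<and> t \<le> 1 \<and>
      norm ((\<Sum>i<k. rank_one (snd (q i)) (fst (q i))) - t *\<^sub>R A) \<le> e)"
proof -
  obtain d g y where d: "0 < (d::nat)" and y: "\<And>j. y j \<noteq> 0"
    and sum: "A = (\<Sum>j<d. rank_one (g j) (y j))"
    using finite_rank_operator_sum[OF A x0] by blast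
  define M where "M = (\<Sum>j<d. norm (rank_one (g j) (y j)))"
  have M0: "0 \<le> M" by (simp add: M_def sum_nonneg)
  \<comment> \<open>An incomplete round has norm at most \<open>M\<close> before weighting, hence
    less than \<open>e\<close> after division by \<open>m\<close>.\<close>
  obtain m :: nat where m: "M / e < m" using reals_Archimedean2 by blast
  have m0: "0 < m"
    using m M0 e by (metis divide_nonneg_pos of_nat_0_less_iff order_le_less_trans)
  define q where "q i = (y (i mod d), (1 / m) *\<^sub>R g (i mod d))" for i
  have part: "(\<Sum>i<a * d + b. rank_one (snd (q i)) (fst (q i)))
      = (a / m) *\<^sub>R A + (1 / m) *\<^sub>R (\<Sum>i<b. rank_one (g i) (y i))" if "b \<le> d" for a b
  proof -
    have "rank_one (snd (q i)) (fst (q i)) = (1 / m) *\<^sub>R rank_one (g (i mod d)) (y (i mod d))" for i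
      by (rule blinfun_eqI) (simp add: q_def blinfun.bilinear_simps)
    then have "(\<Sum>i<a * d + b. rank_one (snd (q i)) (fst (q i)))
        = (1 / m) *\<^sub>R (\<Sum>i<a * d + b. rank_one (g (i mod d)) (y (i mod d)))"
      by (simp add: scaleR_sum_right)
    then show ?thesis
      using sum_mod_periodic[OF that, of "\<lambda>i. rank_one (g i) (y i)" a]
      by (simp add: sum scaleR_add_right)
  qed
  show ?thesis
  proof (intro exI[of _ "m * d"] exI[of _ q] conjI allI impI)
    show "0 < m * d" using m0 d by simp
    show "fst (q i) \<noteq> 0" for i using y by (simp add: q_def)
    show "(\<Sum>i<m * d. rank_one (snd (q i)) (fst (q i))) = A"
      using part[of 0 m] m0 by simp
    fix k assume k: "k < m * d"
    define a b where "a = k div d" and "b = k mod d"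
    have kab: "k = a * d + b" "b < d" using d by (auto simp: a_def b_def)
    have am: "a \<le> m" using k d by (simp add: a_def less_mult_imp_div_less less_imp_le)
    show "\<exists>t. 0 \<le> t \<and> t \<le> 1 \<and>
        norm ((\<Sum>i<k. rank_one (snd (q i)) (fst (q i))) - t *\<^sub>R A) \<le> e"
    proof (intro exI[of _ "a / m"] conjI)
      show "0 \<le> real a / real m" "real a / real m \<le> 1" using am m0 by auto
      have "norm (\<Sum>i<b. rank_one (g i) (y i)) \<le> (\<Sum>i<b. norm (rank_one (g i) (y i)))"
        by (rule norm_sum)
      also have "\<dots> \<le> M" unfolding M_def using kab(2) by (intro sum_mono2) auto
      also have "M \<le> e * m" using m e by (simp add: field_simps)
      finally have "norm (\<Sum>i<b. rank_one (g i) (y i)) \<le> e * m" .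
      then show "norm ((\<Sum>i<k. rank_one (snd (q i)) (fst (q i))) - (a / m) *\<^sub>R A) \<le> e"
        unfolding kab(1) part[OF less_imp_le[OF kab(2)]] using m0 by (simp add: field_simps)
    qed
  qed
qed

text \<open>Index \<open>N\<close> falls into block \<open>\<nu> N\<close>, so the first
  \<open>N\<close> terms are \<open>\<nu> N\<close> complete blocks and a proper, possibly empty,
  beginning of the next. Positive lengths make the starting points \<open>s\<close> strictly
  increasing, whence \<open>\<nu>\<close> tends to infinity.\<close>

lemma concatenate_blocks:
  fixes R :: "'b \<Rightarrow> 'v::real_normed_vector" and A :: "nat \<Rightarrow> 'v"
  assumes blocks: "\<And>n. \<exists>l q. 0 < l \<and> (\<forall>i. P (q i)) \<and> (\<Sum>i<l. R (q i)) = A n \<and>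
    (\<forall>k<l. \<exists>t. 0 \<le> t \<and> t \<le> (1::real) \<and> norm ((\<Sum>i<k::nat. R (q i)) - t *\<^sub>R A n) \<le> e n)"
  obtains p :: "nat \<Rightarrow> 'b" and \<nu> t where "\<And>i. P (p i)" "filterlim \<nu> at_top sequentially"
    "\<And>N. 0 \<le> t N \<and> t N \<le> 1"
    "\<And>N. norm ((\<Sum>i<N. R (p i)) - (\<Sum>j<\<nu> N. A j) - t N *\<^sub>R A (\<nu> N)) \<le> e (\<nu> N)"
proof -
  define Q where "Q n l q \<longleftrightarrow> 0 < l \<and> (\<forall>i. P (q i)) \<and> (\<Sum>i<l. R (q i)) = A n \<and>
    (\<forall>k<l. \<exists>t. 0 \<le> t \<and> t \<le> (1::real) \<and> norm ((\<Sum>i<k. R (q i)) - t *\<^sub>R A n) \<le> e n)"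
    for n l and q :: "nat \<Rightarrow> 'b"
  have "\<exists>l q. Q n l q" for n using blocks by (simp add: Q_def)
  then obtain l q where lq: "\<And>n. Q n (l n) (q n)" by metis
  have l: "0 < l n" and q: "P (q n i)" and tot: "(\<Sum>i<l n. R (q n i)) = A n" for n i
    using lq[of n] by (auto simp: Q_def)
  have part: "\<exists>t. 0 \<le> t \<and> t \<le> 1 \<and> norm ((\<Sum>i<k. R (q n i)) - t *\<^sub>R A n) \<le> e n"
    if "k < l n" for n k
    using lq[of n] that by (auto simp: Q_def)
  define s where "s n = (\<Sum>i<n. l i)" for n
  have s_Suc: "s (Suc n) = s n + l n" for n by (simp add: s_def)
  have mono: "strict_mono s" using l by (simp add: strict_mono_Suc_iff s_Suc)
  define \<nu> where "\<nu> N = (LEAST n. N < s (Suc n))" for N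
  have ex: "\<exists>n. N < s (Suc n)" for N
    using strict_mono_imp_increasing[OF mono, of "Suc N"] by (auto intro: exI[of _ N])
  have up: "N < s (Suc (\<nu> N))" for N
    unfolding \<nu>_def by (rule LeastI_ex[OF ex])
  have lo: "s (\<nu> N) \<le> N" for N
  proof (cases "\<nu> N")
    case 0
    then show ?thesis by (simp add: s_def)
  next
    case (Suc n)
    then have "n < (LEAST n. N < s (Suc n))" by (simp flip: \<nu>_def)
    then have "\<not> N < s (Suc n)" by (rule not_less_Least)
    then show ?thesis by (simp add: Suc)
  qed
  have block: "\<nu> (s n + i) = n" if "i < l n" for n i
  proof (rule antisym)
    show "\<nu> (s n + i) \<le> n"
      unfolding \<nu>_def by (rule Least_le) (use that in \<open>simp add: s_Suc\<close>)
    have "s n < s (Suc (\<nu> (s n + i)))" using up[of "s n + i"] by simp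
    then show "n \<le> \<nu> (s n + i)"
      using mono by (simp add: strict_mono_less)
  qed
  define p where "p N = q (\<nu> N) (N - s (\<nu> N))" for N
  have p: "p (s n + i) = q n i" if "i < l n" for n i
    using block[OF that] by (simp add: p_def)
  have in_block: "(\<Sum>i<s n + k. R (p i)) = (\<Sum>i<s n. R (p i)) + (\<Sum>i<k. R (q n i))"
    if "k \<le> l n" for n k
    using that by (induction k) (auto simp: p add.assoc)
  have sums: "(\<Sum>i<s n. R (p i)) = (\<Sum>j<n. A j)" for n
  proof (induction n)
    case 0
    then show ?case by (simp add: s_def)
  next
    case (Suc n)
    then show ?case using in_block[of "l n" n] by (simp add: s_Suc tot)
  qed
  have "\<exists>t. 0 \<le> t \<and> t \<le> 1 \<and>
      norm ((\<Sum>i<N. R (p i)) - (\<Sum>j<\<nu> N. A j) - t *\<^sub>R A (\<nu> N)) \<le> e (\<nu> N)" for N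
  proof -
    define k where "k = N - s (\<nu> N)"
    have N: "N = s (\<nu> N) + k" using lo[of N] by (simp add: k_def)
    have k: "k < l (\<nu> N)" using up[of N] lo[of N] by (simp add: k_def s_Suc)
    have "(\<Sum>i<N. R (p i)) = (\<Sum>j<\<nu> N. A j) + (\<Sum>i<k. R (q (\<nu> N) i))"
      using in_block[of k "\<nu> N"] k N sums by simp
    then show ?thesis using part[OF k] by simp
  qed
  then have "\<exists>t. \<forall>N. 0 \<le> t N \<and> t N \<le> 1 \<and>
      norm ((\<Sum>i<N. R (p i)) - (\<Sum>j<\<nu> N. A j) - t N *\<^sub>R A (\<nu> N)) \<le> e (\<nu> N)"
    by (intro choice allI)
  then obtain t where "\<And>N. 0 \<le> t N \<and> t N \<le> 1"
      "\<And>N. norm ((\<Sum>i<N. R (p i)) - (\<Sum>j<\<nu> N. A j) - t N *\<^sub>R A (\<nu> N)) \<le> e (\<nu> N)"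
    by blast
  moreover have "filterlim \<nu> at_top sequentially"
    unfolding filterlim_at_top eventually_sequentially
  proof (intro allI exI impI)
    fix Z N assume "s Z \<le> N"
    then have "s Z < s (Suc (\<nu> N))" using up[of N] by simp
    then show "Z \<le> \<nu> N" using mono by (simp add: strict_mono_less)
  qed
  moreover have "P (p i)" for i using q by (simp add: p_def)
  ultimately show thesis using that by blast
qed

text \<open>Evaluation at \<open>x\<close> and composition with \<open>f\<close> are bounded linear
  maps on operators; \<open>conv\<close> treats any such \<open>\<Phi>\<close>, so one sequence of
  pairs expands both the space and its dual.\<close>

lemma shrinking_frame_from_operators:
  fixes T :: "nat \<Rightarrow> 'a::banach \<Rightarrow>\<^sub>L 'a" and x0 :: 'a
  assumes T: "\<And>n. T n \<in> finite_rank_operators" and Tx: "\<And>x. (\<lambda>n. T n x) \<longlonglongrightarrow> x"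
    and Tf: "\<And>f :: 'a \<Rightarrow>\<^sub>L real. (\<lambda>n. f o\<^sub>L T n) \<longlonglongrightarrow> f" and x0: "x0 \<noteq> 0"
  shows "\<exists>p :: nat \<Rightarrow> 'a \<times> ('a \<Rightarrow>\<^sub>L real). schauder_frame p \<and> shrinking p"
proof -
  \<comment> \<open>The shift makes the differences telescope from 0: the first block is
    \<open>T 0\<close> itself.\<close>
  define U where "U n = (case n of 0 \<Rightarrow> 0 | Suc k \<Rightarrow> T k)" for n
  define A where "A n = U (Suc n) - U n" for n
  have "U n \<in> finite_rank_operators" for n
    using T by (cases n) (auto simp: U_def span_zero)
  then have A: "A n \<in> finite_rank_operators" for n by (simp add: A_def span_diff)
  have sumA: "(\<Sum>j<n. A j) = U n" for n
    unfolding A_def by (simp add: sum_lessThan_telescope) (simp add: U_def)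
  define R where "R = (\<lambda>q :: 'a \<times> ('a \<Rightarrow>\<^sub>L real). rank_one (snd q) (fst q))"
  obtain p :: "nat \<Rightarrow> 'a \<times> ('a \<Rightarrow>\<^sub>L real)" and \<nu> t
    where p: "\<And>i. fst (p i) \<noteq> 0" and \<nu>: "filterlim \<nu> at_top sequentially"
      and t: "\<And>N. 0 \<le> t N \<and> t N \<le> 1"
      and err: "\<And>N. norm ((\<Sum>i<N. R (p i)) - (\<Sum>j<\<nu> N. A j) - t N *\<^sub>R A (\<nu> N))
        \<le> inverse (real (Suc (\<nu> N)))"
  proof (rule concatenate_blocks[where P = "\<lambda>q. fst q \<noteq> 0" and R = R and A = A
        and e = "\<lambda>n. inverse (real (Suc n))"])
    show "\<exists>(l::nat) q. 0 < l \<and> (\<forall>i. fst (q i) \<noteq> 0) \<and> (\<Sum>i<l. R (q i)) = A n \<and>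
      (\<forall>k<l. \<exists>t. 0 \<le> t \<and> t \<le> 1 \<and> norm ((\<Sum>i<k. R (q i)) - t *\<^sub>R A n) \<le> inverse (real (Suc n)))" for n
      unfolding R_def by (rule rank_one_block[OF A x0]) simp
  qed blast
  have conv: "(\<lambda>N. \<Sum>i<N. \<Phi> (R (p i))) \<longlonglongrightarrow> w"
    if \<Phi>: "bounded_linear \<Phi>" and lim: "(\<lambda>n. \<Phi> (T n)) \<longlonglongrightarrow> w"
    for \<Phi> :: "('a \<Rightarrow>\<^sub>L 'a) \<Rightarrow> 'w::real_normed_vector" and w
  proof -
    interpret bounded_linear \<Phi> by (rule \<Phi>)
    have U_Suc: "(\<lambda>n. \<Phi> (U (Suc n))) \<longlonglongrightarrow> w" using lim by (simp add: U_def)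
    then have U: "(\<lambda>n. \<Phi> (U n)) \<longlonglongrightarrow> w" by (rule LIMSEQ_imp_Suc)
    \<comment> \<open>Under \<open>\<Phi>\<close> the differences tend to 0, so an unfinished block
      is harmless: its factor \<open>t N\<close> is bounded.\<close>
    have "(\<lambda>n. \<Phi> (A n)) \<longlonglongrightarrow> w - w"
      unfolding A_def diff using U_Suc U by (rule tendsto_diff)
    then have A0: "(\<lambda>N. \<Phi> (A (\<nu> N))) \<longlonglongrightarrow> 0"
      using filterlim_compose[OF _ \<nu>, of "\<lambda>n. \<Phi> (A n)" "nhds 0"] by simp
    have "Bfun t sequentially" using t by (intro BfunI[of _ 1]) auto
    then have tA: "(\<lambda>N. t N *\<^sub>R \<Phi> (A (\<nu> N))) \<longlonglongrightarrow> 0"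
      using A0 by (intro tendsto_Zfun_iff[THEN iffD2])
        (auto simp: tendsto_Zfun_iff intro: bounded_bilinear.Bfun_prod_Zfun[OF bounded_bilinear_scaleR])
    have "(\<lambda>N. inverse (real (Suc (\<nu> N)))) \<longlonglongrightarrow> 0"
      by (rule filterlim_compose[OF LIMSEQ_inverse_real_of_nat \<nu>])
    then have "(\<lambda>N. (\<Sum>i<N. R (p i)) - (\<Sum>j<\<nu> N. A j) - t N *\<^sub>R A (\<nu> N)) \<longlonglongrightarrow> 0"
      by (rule Lim_null_comparison[OF always_eventually[OF allI[OF err]]])
    then have "(\<lambda>N. \<Phi> ((\<Sum>i<N. R (p i)) - (\<Sum>j<\<nu> N. A j) - t N *\<^sub>R A (\<nu> N))) \<longlonglongrightarrow> \<Phi> 0"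
      by (rule tendsto)
    then have "(\<lambda>N. \<Phi> (\<Sum>i<N. R (p i)) - \<Phi> (U (\<nu> N)) - t N *\<^sub>R \<Phi> (A (\<nu> N))) \<longlonglongrightarrow> 0"
      by (simp add: sumA diff scaleR zero)
    from tendsto_add[OF tendsto_add[OF this tA] filterlim_compose[OF U \<nu>]]
    show ?thesis by (simp add: sum)
  qed
  have "(\<lambda>i. snd (p i) x *\<^sub>R fst (p i)) sums x" for x
    unfolding sums_def using conv[OF blinfun.bounded_linear_left Tx] by (simp add: R_def)
  moreover have "(\<lambda>i. f (fst (p i)) *\<^sub>R snd (p i)) sums f" for f :: "'a \<Rightarrow>\<^sub>L real"
  proof -
    have "f o\<^sub>L R (p i) = f (fst (p i)) *\<^sub>R snd (p i)" for i
      by (rule blinfun_eqI) (simp add: R_def blinfun.bilinear_simps)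
    then show ?thesis
      unfolding sums_def
      using conv[OF bounded_bilinear.bounded_linear_right[OF bounded_bilinear_blinfun_compose] Tf[of f]]
      by simp
  qed
  ultimately show ?thesis
    unfolding schauder_frame_def shrinking_def using p by blast
qed

section \<open>From a shrinking frame back to the dual\<close>

lemma bounded_approximation_property_from_expansion:
  fixes x :: "nat \<Rightarrow> 'a::banach \<Rightarrow>\<^sub>L real" and y :: "nat \<Rightarrow> 'a"
  assumes "\<And>f. (\<lambda>i. x i f *\<^sub>R y i) sums f"
  shows "bounded_approximation_property TYPE('a)"
proof -
  define B where "B n = (\<Sum>i<n. rank_one (x i) (y i))" for n
  have B: "B n f = (\<Sum>i<n. x i f *\<^sub>R y i)" for n f
    by (simp add: B_def blinfun.sum_left)
  have "range (blinfun_apply (B n)) \<subseteq> span (y ` {..<n})" for n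
    by (auto simp: B intro: span_sum span_scale span_base)
  then have "finite_rank (B n)" for n
    unfolding finite_rank_def finite_dim_set_def by blast
  moreover have "(\<lambda>n. norm (f - B n f)) \<longlonglongrightarrow> 0" for f
    using tendsto_norm[OF tendsto_diff[OF tendsto_const[of f] assms[of f, unfolded sums_def]]]
    by (simp add: B)
  ultimately show ?thesis
    unfolding bounded_approximation_property_def by blast
qed

text \<open>Finite rational combinations of the \<open>y i\<close>, coded by lists of rationals,
  form a countable dense set.\<close>

lemma separable_from_expansion:
  fixes y :: "nat \<Rightarrow> 'a::real_normed_vector"
  assumes "\<And>f. (\<lambda>i. a f i *\<^sub>R y i) sums f"
  shows "separable_space (euclidean :: 'a topology)"
proof -
  define c where "c r = (\<Sum>i<length r. of_rat (r ! i) *\<^sub>R y i)" for r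
  have "f \<in> closure (range c)" for f
    unfolding closure_approachable
  proof (intro allI impI)
    fix e :: real assume e: "0 < e"
    obtain n where n: "norm ((\<Sum>i<n. a f i *\<^sub>R y i) - f) < e / 2"
      using LIMSEQ_D[OF assms[of f, unfolded sums_def], of "e / 2"] e by auto
    \<comment> \<open>Rounding each coefficient within \<open>e / (2 * s)\<close> moves the partial
      sum by at most \<open>e / 2\<close>; the added 1 keeps \<open>s\<close> positive.\<close>
    define s where "s = (\<Sum>i<n. norm (y i)) + 1"
    have s: "0 < s" by (simp add: s_def add_nonneg_pos sum_nonneg)
    have "\<exists>q. \<bar>of_rat q - a f i\<bar> \<le> e / (2 * s)" for i
    proof -
      have "a f i - e / (2 * s) < a f i + e / (2 * s)" using e s by simp
      then obtain q where "a f i - e / (2 * s) < of_rat q" "of_rat q < a f i + e / (2 * s)"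
        using of_rat_dense by blast
      then have "\<bar>of_rat q - a f i\<bar> \<le> e / (2 * s)" by linarith
      then show ?thesis ..
    qed
    then obtain q where q: "\<And>i. \<bar>of_rat (q i) - a f i\<bar> \<le> e / (2 * s)" by metis
    have "norm (\<Sum>i<n. (of_rat (q i) - a f i) *\<^sub>R y i) \<le> (\<Sum>i<n. e / (2 * s) * norm (y i))"
      using mult_right_mono[OF q norm_ge_zero] by (intro sum_norm_le) simp
    also have "\<dots> \<le> e / (2 * s) * s"
      unfolding sum_distrib_left[symmetric] using e s by (intro mult_left_mono) (auto simp: s_def)
    also have "\<dots> = e / 2" using s by simp
    finally have le: "norm (\<Sum>i<n. (of_rat (q i) - a f i) *\<^sub>R y i) \<le> e / 2" .
    have "c (map q [0..<n]) - f
        = (\<Sum>i<n. (of_rat (q i) - a f i) *\<^sub>R y i) + ((\<Sum>i<n. a f i *\<^sub>R y i) - f)"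
      by (simp add: c_def scaleR_diff_left sum_subtractf)
    then have "dist (c (map q [0..<n])) f
        \<le> norm (\<Sum>i<n. (of_rat (q i) - a f i) *\<^sub>R y i) + norm ((\<Sum>i<n. a f i *\<^sub>R y i) - f)"
      using norm_triangle_ineq by (simp only: dist_norm)
    then have "dist (c (map q [0..<n])) f < e" using le n by linarith
    then show "\<exists>z\<in>range c. dist z f < e" by blast
  qed
  then have "closure (range c) = UNIV" by blast
  moreover have "countable (range c)" by simp
  ultimately show ?thesis
    unfolding separable_space_def by (intro exI[of _ "range c"]) simp
qed

theorem theorem5p3:
  assumes "\<not> finite_dim_set (UNIV :: 'a::banach set)"
    and "separable_space (euclidean :: 'a topology)"
  shows "separable_space (euclidean :: ('a \<Rightarrow>\<^sub>L real) topology) \<and>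
         bounded_approximation_property TYPE('a \<Rightarrow>\<^sub>L real) \<longleftrightarrow>
         (\<exists>p :: nat \<Rightarrow> 'a \<times> ('a \<Rightarrow>\<^sub>L real). schauder_frame p \<and> shrinking p)"
proof
  assume *: "separable_space (euclidean :: ('a \<Rightarrow>\<^sub>L real) topology) \<and>
    bounded_approximation_property TYPE('a \<Rightarrow>\<^sub>L real)"
  \<comment> \<open>Infinite dimension supplies the nonzero vector that stands in for zero operators
    in the frame.\<close>
  have "\<exists>x0 :: 'a. x0 \<noteq> 0"
  proof (rule ccontr)
    assume "\<not> ?thesis"
    then have "(UNIV :: 'a set) \<subseteq> span {}" by auto
    then show False using assms(1) unfolding finite_dim_set_def by blast
  qed
  then show "\<exists>p :: nat \<Rightarrow> 'a \<times> ('a \<Rightarrow>\<^sub>L real). schauder_frame p \<and> shrinking p"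
    using approximating_operators[OF assms(2)] * shrinking_frame_from_operators by blast
next
  assume "\<exists>p :: nat \<Rightarrow> 'a \<times> ('a \<Rightarrow>\<^sub>L real). schauder_frame p \<and> shrinking p"
  then obtain p :: "nat \<Rightarrow> 'a \<times> ('a \<Rightarrow>\<^sub>L real)" where "shrinking p" by blast
  then have p: "(\<lambda>i. f (fst (p i)) *\<^sub>R snd (p i)) sums f" for f :: "'a \<Rightarrow>\<^sub>L real"
    by (simp add: shrinking_def)
  \<comment> \<open>The coefficient functionals on the dual are evaluations at the frame vectors,
    elements of the bidual.\<close>
  define x where "x i = Blinfun (\<lambda>f :: 'a \<Rightarrow>\<^sub>L real. f (fst (p i)))" for i
  have "x i f = f (fst (p i))" for i f
    by (simp add: x_def bounded_linear_Blinfun_apply blinfun.bounded_linear_left)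
  then have "(\<lambda>i. x i f *\<^sub>R snd (p i)) sums f" for f using p by simp
  then have "bounded_approximation_property TYPE('a \<Rightarrow>\<^sub>L real)"
    by (rule bounded_approximation_property_from_expansion)
  then show "separable_space (euclidean :: ('a \<Rightarrow>\<^sub>L real) topology) \<and>
    bounded_approximation_property TYPE('a \<Rightarrow>\<^sub>L real)"
    using separable_from_expansion[OF p] by simp
qed

end
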